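(* For a group $G$, the following conditions are equivalent: (1) The Andreadakis equality holds for $\mathrm{Inn}(G)$. (2) Every homogeneous central element of $\mathcal{L}(G)$ is the class of some central element of $G$. (3) The canonical projection $\mathcal{L}(G/\mathcal{Z}(G))\twoheadrightarrow\mathcal{L}(G)/\mathfrak{z}(\mathcal{L}(G))=\mathrm{ad}(\mathcal{L}(G))$ is an isomorphism.
   Context: For a group $G$: $\mathcal{Z}(G)$ is its center; $\mathrm{Inn}(G)\cong G/\mathcal{Z}(G)$ is its group of inner automorphisms; $\Gamma_1(G)=G$, $\Gamma_{i+1}(G)=[G,\Gamma_i(G)]$ is its lower central series; $\mathcal{L}(G)=\bigoplus_{i\geq1}\Gamma_i(G)/\Gamma_{i+1}(G)$ is the associated graded Lie ring, with bracket induced by commutators. An element $g\in\Gamma_i(G)$ has a class in $\mathcal{L}_i(G)=\Gamma_i(G)/\Gamma_{i+1}(G)$; condition (2) means that each homogeneous central element of degree $i$ is the class in $\mathcal{L}_i(G)$ of an element of $\mathcal{Z}(G)\cap\Gamma_i(G)$. For a Lie ring $\mathfrak{g}$, $\mathfrak{z}(\mathfrak{g})$ is its center and $\mathrm{ad}(\mathfrak{g})\cong\mathfrak{g}/\mathfrak{z}(\mathfrak{g})$ is its Lie ring of inner derivations. The quotient map $G\to G/\mathcal{Z}(G)$ induces a surjection $\mathcal{L}(G)\twoheadrightarrow\mathcal{L}(G/\mathcal{Z}(G))$, whose kernel is the Lie subring $\bigoplus_i(\Gamma_i(G)\cap\mathcal{Z}(G))/(\Gamma_{i+1}(G)\cap\mathcal{Z}(G))$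 of $\mathcal{L}(G)$, which is contained in $\mathfrak{z}(\mathcal{L}(G))$; the canonical projection in (3) is the resulting factorization of $\mathcal{L}(G)\twoheadrightarrow\mathcal{L}(G)/\mathfrak{z}(\mathcal{L}(G))$. The Andreadakis filtration is $\mathcal{A}_j(G)=\{\varphi\in\mathrm{Aut}(G) : \forall i\geq1,\ \forall g\in\Gamma_i(G),\ \varphi(g)g^{-1}\in\Gamma_{i+j}(G)\}$, and $IA_G=\mathcal{A}_1(G)$ is the group of automorphisms acting trivially on $G^{ab}$. A subgroup $K\subseteq IA_G$ satisfies the Andreadakis equality (or: the Andreadakis equality holds for $K$) if the inclusions $\Gamma_j(K)\subseteq K\cap\Gamma_j(IA_G)\subseteq K\cap\mathcal{A}_j(G)$ are equalities for all $j\geq1$. *)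

theory Defs
  imports "HOL-Algebra.Bij" "HOL-Algebra.Product_Groups" "HOL-Algebra.FiniteProduct"
begin

section \<open>Groups\<close>

definition group_center :: "('a, 'm) monoid_scheme \<Rightarrow> 'a set" where
  "group_center G = {z \<in> carrier G. \<forall>g \<in> carrier G. z \<otimes>\<^bsub>G\<^esub> g = g \<otimes>\<^bsub>G\<^esub> z}"

definition commutator :: "('a, 'm) monoid_scheme \<Rightarrow> 'a \<Rightarrow> 'a \<Rightarrow> 'a" where
  "commutator G x y = x \<otimes>\<^bsub>G\<^esub> y \<otimes>\<^bsub>G\<^esub> inv\<^bsub>G\<^esub> x \<otimes>\<^bsub>G\<^esub> inv\<^bsub>G\<^esub> y"

text \<open>
  The lower central series is indexed from 1, as usual for the associated graded Lie ring;
  the value at index 0 is a dummy and is never used.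
\<close>

fun lower_central :: "('a, 'm) monoid_scheme \<Rightarrow> nat \<Rightarrow> 'a set" where
  "lower_central G 0 = carrier G"
| "lower_central G (Suc 0) = carrier G"
| "lower_central G (Suc (Suc n)) =
     generate G {commutator G g h | g h. g \<in> carrier G \<and> h \<in> lower_central G (Suc n)}"


section \<open>Lie rings\<close>

text \<open>
  The additive group of a Lie ring is stored in the monoid fields, so it is written
  multiplicatively: \<open>\<one>\<close> is the zero of the Lie ring and \<open>\<otimes>\<close> its addition.
\<close>

record 'a lie_ring = "'a monoid" +
  bracket :: "'a \<Rightarrow> 'a \<Rightarrow> 'a"

definition lie_center :: "('a, 'm) lie_ring_scheme \<Rightarrow> 'a set" where
  "lie_center L = {z \<in> carrier L. \<forall>x \<in> carrier L. bracket L z x = \<one>\<^bsub>L\<^esub>}"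

text \<open>
  The bracket of two cosets of a Lie ideal \<open>I\<close> is written as the union of the cosets of the
  brackets of all representatives; these cosets all coincide.
\<close>

definition lie_quotient :: "('a, 'm) lie_ring_scheme \<Rightarrow> 'a set \<Rightarrow> 'a set lie_ring" where
  "lie_quotient L I =
     \<lparr>carrier = carrier (L Mod I), mult = mult (L Mod I), one = one (L Mod I),
      bracket = (\<lambda>X Y. \<Union>x \<in> X. \<Union>y \<in> Y. I #>\<^bsub>L\<^esub> bracket L x y)\<rparr>"

definition lie_iso :: "('a, 'm) lie_ring_scheme \<Rightarrow> ('b, 'n) lie_ring_scheme \<Rightarrow> ('a \<Rightarrow> 'b) set" where
  "lie_iso L M =
     {h \<in> iso L M. \<forall>x \<in> carrier L. \<forall>y \<in> carrier L. h (bracket L x y) = bracket M (h x) (h y)}"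


section \<open>The Lie ring of a group\<close>

definition gr :: "('a, 'm) monoid_scheme \<Rightarrow> nat \<Rightarrow> 'a set monoid" where
  "gr G i = (G\<lparr>carrier := lower_central G i\<rparr>) Mod lower_central G (Suc i)"

text \<open>
  The bracket of classes of degrees \<open>i\<close> and \<open>j\<close>. As for quotients, the union is over equal cosets:
  the class of \<open>[x, y]\<close> does not depend on the representatives \<open>x\<close>, \<open>y\<close>.
\<close>

definition gr_bracket :: "('a, 'm) monoid_scheme \<Rightarrow> nat \<Rightarrow> nat \<Rightarrow> 'a set \<Rightarrow> 'a set \<Rightarrow> 'a set" where
  "gr_bracket G i j X Y =
     (\<Union>x \<in> X. \<Union>y \<in> Y. lower_central G (Suc (i + j)) #>\<^bsub>G\<^esub> commutator G x y)"

text \<open>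
  An element of the direct sum is a finitely supported family \<open>x\<close> with \<open>x i \<in> carrier (gr G i)\<close>
  for \<open>i \<ge> 1\<close>. The component of degree \<open>n\<close> of a bracket collects the brackets
  of components whose degrees add up to \<open>n\<close>.
\<close>

definition group_lie_ring :: "('a, 'm) monoid_scheme \<Rightarrow> (nat \<Rightarrow> 'a set) lie_ring" where
  "group_lie_ring G =
     \<lparr>carrier = carrier (sum_group {1..} (gr G)),
      mult = mult (sum_group {1..} (gr G)),
      one = one (sum_group {1..} (gr G)),
      bracket = (\<lambda>x y. \<lambda>n \<in> {1..}.
        finprod (gr G n) (\<lambda>i. gr_bracket G i (n - i) (x i) (y (n - i))) {1..<n})\<rparr>"

definition homogeneous :: "('a, 'm) monoid_scheme \<Rightarrow> nat \<Rightarrow> (nat \<Rightarrow> 'a set) \<Rightarrow> bool" where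
  "homogeneous G i x \<longleftrightarrow>
     x \<in> carrier (group_lie_ring G) \<and> (\<forall>j \<ge> 1. j \<noteq> i \<longrightarrow> x j = \<one>\<^bsub>gr G j\<^esub>)"

text \<open>The class of \<open>g \<in> lower_central G i\<close> in degree \<open>i\<close>, seen in the direct sum.\<close>

definition lie_class :: "('a, 'm) monoid_scheme \<Rightarrow> nat \<Rightarrow> 'a \<Rightarrow> nat \<Rightarrow> 'a set" where
  "lie_class G i g =
     (\<lambda>j \<in> {1..}. if j = i then lower_central G (Suc i) #>\<^bsub>G\<^esub> g else \<one>\<^bsub>gr G j\<^esub>)"

text \<open>
  The map induced on Lie rings by a group homomorphism \<open>f\<close> into \<open>H\<close>; it sends the class of
  \<open>a\<close> to the class of \<open>f a\<close>. Again the union is over equal cosets.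
\<close>

definition lie_map :: "('b, 'n) monoid_scheme \<Rightarrow> ('a \<Rightarrow> 'b) \<Rightarrow> (nat \<Rightarrow> 'a set) \<Rightarrow> nat \<Rightarrow> 'b set" where
  "lie_map H f x = (\<lambda>i \<in> {1..}. \<Union>a \<in> x i. lower_central H (Suc i) #>\<^bsub>H\<^esub> f a)"

text \<open>
  The projection from the Lie ring of \<open>G Mod group_center G\<close> onto the quotient of the Lie ring of
  \<open>G\<close> by its center: the factorization of the quotient map \<open>x \<mapsto> lie_center (group_lie_ring G) #> x\<close>
  through the surjection induced by \<open>G \<rightarrow> G Mod group_center G\<close>.
\<close>

definition canonical_projection ::
    "('a, 'm) monoid_scheme \<Rightarrow> (nat \<Rightarrow> 'a set set) \<Rightarrow> (nat \<Rightarrow> 'a set) set" where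
  "canonical_projection G y =
     (THE Y. \<exists>x \<in> carrier (group_lie_ring G).
        lie_map (G Mod group_center G) (\<lambda>g. group_center G #>\<^bsub>G\<^esub> g) x = y \<and>
        Y = lie_center (group_lie_ring G) #>\<^bsub>group_lie_ring G\<^esub> x)"


section \<open>The Andreadakis filtration\<close>

definition Inn :: "('a, 'm) monoid_scheme \<Rightarrow> ('a \<Rightarrow> 'a) set" where
  "Inn G = (\<lambda>g. \<lambda>x \<in> carrier G. g \<otimes>\<^bsub>G\<^esub> x \<otimes>\<^bsub>G\<^esub> inv\<^bsub>G\<^esub> g) ` carrier G"

definition andreadakis :: "('a, 'm) monoid_scheme \<Rightarrow> nat \<Rightarrow> ('a \<Rightarrow> 'a) set" where
  "andreadakis G j =
     {\<phi> \<in> carrier (AutoGroup G). \<forall>i \<ge> 1. \<forall>g \<in> lower_central G i.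
        \<phi> g \<otimes>\<^bsub>G\<^esub> inv\<^bsub>G\<^esub> g \<in> lower_central G (i + j)}"

definition IA :: "('a, 'm) monoid_scheme \<Rightarrow> ('a \<Rightarrow> 'a) set" where
  "IA G = andreadakis G 1"

definition andreadakis_equality :: "('a, 'm) monoid_scheme \<Rightarrow> ('a \<Rightarrow> 'a) set \<Rightarrow> bool" where
  "andreadakis_equality G K \<longleftrightarrow>
     subgroup K (AutoGroup G) \<and> K \<subseteq> IA G \<and>
     (\<forall>j \<ge> 1.
        lower_central (AutoGroup G\<lparr>carrier := K\<rparr>) j
          = K \<inter> lower_central (AutoGroup G\<lparr>carrier := IA G\<rparr>) j \<and>
        K \<inter> lower_central (AutoGroup G\<lparr>carrier := IA G\<rparr>) j = K \<inter> andreadakis G j)"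

end

theory Submission
  imports Defs
begin

text \<open>
  All three conditions say the same about single elements. Call \<open>g\<close> degree raising by \<open>j\<close> if
  \<open>[g, \<Gamma>\<^sub>i] \<subseteq> \<Gamma>\<^sub>i\<^sub>+\<^sub>j\<close> for all \<open>i \<ge> 1\<close>, that is, if conjugation by \<open>g\<close> lies in the \<open>j\<close>-th term of
  the Andreadakis filtration. For \<open>g \<in> \<Gamma>\<^sub>i\<close>, the class of \<open>g\<close> in degree \<open>i\<close> is central in the
  Lie ring iff \<open>g\<close> is degree raising by \<open>i + 1\<close>, and it is killed by the map to the Lie ring of
  \<open>G/Z\<close> iff it is the class of a central element of \<open>G\<close> in \<open>\<Gamma>\<^sub>i\<close>. Since the center of the Lie
  ring is graded, conditions (2) and (3) both say that every \<open>g \<in> \<Gamma>\<^sub>i\<close> which is degree raising by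
  \<open>i + 1\<close> lies in \<open>\<Gamma>\<^sub>i\<^sub>+\<^sub>1 (Z \<inter> \<Gamma>\<^sub>i)\<close>. Condition (1) says that every \<open>g\<close> which is degree raising by
  \<open>j\<close> lies in \<open>\<Gamma>\<^sub>j Z\<close>; this follows from the former by induction on \<open>j\<close>, correcting \<open>g\<close> by
  central elements one degree at a time.
\<close>


section \<open>The lower central series\<close>

context group
begin

text \<open>Cancels an inverse inside a right-associated word; with \<open>m_assoc\<close> and the
  mirror rule below, \<open>simp\<close> can verify identities between group words.\<close>

lemma inv_mult_cancel_left [simp]:
  "\<lbrakk>x \<in> carrier G; y \<in> carrier G\<rbrakk> \<Longrightarrow> inv x \<otimes> (x \<otimes> y) = y"
  by (simp flip: m_assoc)

lemma mult_inv_cancel_left [simp]: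
  "\<lbrakk>x \<in> carrier G; y \<in> carrier G\<rbrakk> \<Longrightarrow> x \<otimes> (inv x \<otimes> y) = y"
  by (simp flip: m_assoc)

lemma commutator_closed [simp]:
  "\<lbrakk>x \<in> carrier G; y \<in> carrier G\<rbrakk> \<Longrightarrow> commutator G x y \<in> carrier G"
  by (simp add: commutator_def)

lemma inv_commutator:
  "\<lbrakk>x \<in> carrier G; y \<in> carrier G\<rbrakk> \<Longrightarrow> inv (commutator G x y) = commutator G y x"
  by (simp add: commutator_def inv_mult_group m_assoc)

text \<open>The nested commutator has a higher degree than the other two factors; dropping it turns
  the identity into additivity of the Lie bracket.\<close>

lemma commutator_mult_left:
  "\<lbrakk>x \<in> carrier G; y \<in> carrier G; z \<in> carrier G\<rbrakk> \<Longrightarrow>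
   commutator G (x \<otimes> y) z
     = commutator G x (commutator G y z) \<otimes> (commutator G y z \<otimes> commutator G x z)"
  by (simp add: commutator_def inv_mult_group m_assoc)

text \<open>Used to evaluate a commutator of automorphisms at a point in the image of
  \<open>y \<otimes> x\<close>, without computing inverse automorphisms.\<close>

lemma commutator_mult_swap:
  "\<lbrakk>x \<in> carrier G; y \<in> carrier G\<rbrakk> \<Longrightarrow> commutator G x y \<otimes> (y \<otimes> x) = x \<otimes> y"
  by (simp add: commutator_def m_assoc)

lemma commutator_one_right [simp]: "x \<in> carrier G \<Longrightarrow> commutator G x \<one> = \<one>"
  by (simp add: commutator_def)

end

lemma (in group_hom) hom_commutator:
  "\<lbrakk>x \<in> carrier G; y \<in> carrier G\<rbrakk> \<Longrightarrow>
   h (commutator G x y) = commutator H (h x) (h y)"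
  by (simp add: commutator_def)

lemma lower_central_Suc:
  "n \<ge> 1 \<Longrightarrow> lower_central G (Suc n) =
     generate G {commutator G g h | g h. g \<in> carrier G \<and> h \<in> lower_central G n}"
  by (cases n) auto

context group
begin

lemma lower_central_subgroup: "subgroup (lower_central G n) G"
proof (induction n)
  case 0
  show ?case by (simp add: subgroup_self)
next
  case (Suc n)
  show ?case
  proof (cases "n = 0")
    case False
    then show ?thesis
      using subgroup.mem_carrier[OF Suc.IH]
      by (subst lower_central_Suc) (auto intro!: generate_is_subgroup)
  qed (simp add: subgroup_self)
qed

lemma lower_central_carrier: "x \<in> lower_central G n \<Longrightarrow> x \<in> carrier G"
  using subgroup.mem_carrier[OF lower_central_subgroup] .

lemma lower_central_one [simp]: "\<one> \<in> lower_central G n"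
  using subgroup.one_closed[OF lower_central_subgroup] .

lemma lower_central_mult:
  "\<lbrakk>x \<in> lower_central G n; y \<in> lower_central G n\<rbrakk> \<Longrightarrow> x \<otimes> y \<in> lower_central G n"
  using subgroup.m_closed[OF lower_central_subgroup] .

lemma lower_central_inv: "x \<in> lower_central G n \<Longrightarrow> inv x \<in> lower_central G n"
  using subgroup.m_inv_closed[OF lower_central_subgroup] .

lemma commutator_lower_central:
  "\<lbrakk>n \<ge> 1; x \<in> carrier G; y \<in> lower_central G n\<rbrakk> \<Longrightarrow>
   commutator G x y \<in> lower_central G (Suc n)"
  by (subst lower_central_Suc) (auto intro!: generate.incl)

lemma commutator_lower_central':
  "\<lbrakk>n \<ge> 1; x \<in> carrier G; y \<in> lower_central G n\<rbrakk> \<Longrightarrow>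
   commutator G y x \<in> lower_central G (Suc n)"
  using lower_central_inv[OF commutator_lower_central, of n x y]
  by (simp add: inv_commutator lower_central_carrier)

text \<open>Conjugating a generator conjugates both entries of the commutator, and the second entry
  stays in the previous term by induction. So the generating set is closed under
  conjugation.\<close>

lemma lower_central_normal: "lower_central G n \<lhd> G"
proof (induction n)
  case 0
  show ?case by (simp add: normal_invI subgroup_self)
next
  case (Suc n)
  show ?case
  proof (cases "n = 0")
    case True
    then show ?thesis by (simp add: normal_invI subgroup_self)
  next
    case False
    let ?C = "{commutator G g h | g h. g \<in> carrier G \<and> h \<in> lower_central G n}"
    have "k \<otimes> c \<otimes> inv k \<in> ?C" if c: "c \<in> ?C" and k: "k \<in> carrier G" for c k
    proof -
      obtain g h where gh: "c = commutator G g h" "g \<in> carrier G" "h \<in> lower_central G n"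
        using c by blast
      have "k \<otimes> c \<otimes> inv k = commutator G (k \<otimes> g \<otimes> inv k) (k \<otimes> h \<otimes> inv k)"
        using gh lower_central_carrier[OF gh(3)] k
        by (simp add: commutator_def inv_mult_group m_assoc)
      moreover have "k \<otimes> h \<otimes> inv k \<in> lower_central G n"
        using normal.inv_op_closed2[OF Suc.IH k gh(3)] .
      ultimately show ?thesis using gh k by blast
    qed
    moreover have "?C \<subseteq> carrier G" by (auto simp: lower_central_carrier)
    ultimately show ?thesis
      using False normal_generateI[of ?C] by (simp add: lower_central_Suc)
  qed
qed

text \<open>\<open>commutator G g h\<close> is the product of
  \<open>g \<otimes> h \<otimes> inv g\<close> and \<open>inv h\<close>, both in the n-th term by
  normality.\<close>

lemma lower_central_Suc_subset: "lower_central G (Suc n) \<subseteq> lower_central G n"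
proof (cases "n = 0")
  case False
  have "commutator G g h \<in> lower_central G n"
    if "g \<in> carrier G" "h \<in> lower_central G n" for g h
  proof -
    have "g \<otimes> h \<otimes> inv g \<in> lower_central G n"
      using normal.inv_op_closed2[OF lower_central_normal that] .
    then show ?thesis
      using that by (auto simp: commutator_def intro: lower_central_mult lower_central_inv)
  qed
  then have "{commutator G g h | g h. g \<in> carrier G \<and> h \<in> lower_central G n}
      \<subseteq> lower_central G n"
    by blast
  from generate_subgroup_incl[OF this lower_central_subgroup] show ?thesis
    using False by (simp add: lower_central_Suc)
qed auto

end

section \<open>Lower central series under homomorphisms\<close>

lemma (in group_hom) lower_central_img_subset:
  "h ` lower_central G n \<subseteq> lower_central H n"
proof (induction n)
  case (Suc n)
  show ?case
  proof (cases "n = 0")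
    case False
    let ?C = "{commutator G g k | g k. g \<in> carrier G \<and> k \<in> lower_central G n}"
    have "h (commutator G g k) \<in> lower_central H (Suc n)"
      if "g \<in> carrier G" "k \<in> lower_central G n" for g k
      using that Suc.IH False H.commutator_lower_central[of n "h g" "h k"]
      by (auto simp: hom_commutator G.lower_central_carrier)
    then have "h ` ?C \<subseteq> lower_central H (Suc n)" by blast
    then have "generate H (h ` ?C) \<subseteq> lower_central H (Suc n)"
      by (rule H.generate_subgroup_incl[OF _ H.lower_central_subgroup])
    moreover have "?C \<subseteq> carrier G" by (auto simp: G.lower_central_carrier)
    ultimately show ?thesis
      using False generate_img[of ?C] by (simp add: lower_central_Suc)
  qed auto
qed auto

text \<open>Surjectivity lifts the first entry of a commutator in \<open>H\<close>, the induction
  hypothesis lifts the second; hence generators correspond exactly.\<close>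

lemma (in group_hom) lower_central_img:
  assumes surj: "h ` carrier G = carrier H"
  shows "h ` lower_central G n = lower_central H n"
proof (induction n)
  case 0
  show ?case by (simp add: surj)
next
  case (Suc n)
  show ?case
  proof (cases "n = 0")
    case True
    then show ?thesis by (simp add: surj)
  next
    case False
    let ?C = "{commutator G g k | g k. g \<in> carrier G \<and> k \<in> lower_central G n}"
    let ?D = "{commutator H g k | g k. g \<in> carrier H \<and> k \<in> lower_central H n}"
    have "h ` ?C = ?D"
    proof
      show "h ` ?C \<subseteq> ?D"
      proof clarify
        fix g k assume "g \<in> carrier G" "k \<in> lower_central G n"
        then have "h (commutator G g k) = commutator H (h g) (h k)" "h k \<in> lower_central H n"
          using Suc.IH by (auto simp: hom_commutator G.lower_central_carrier)
        then show "\<exists>g' k'. h (commutator G g k) = commutator H g' k' \<and>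
            g' \<in> carrier H \<and> k' \<in> lower_central H n"
          using \<open>g \<in> carrier G\<close> hom_closed by blast
      qed
      show "?D \<subseteq> h ` ?C"
      proof
        fix d assume "d \<in> ?D"
        then obtain g k where "g \<in> carrier G" "k \<in> lower_central G n"
          "d = commutator H (h g) (h k)"
          unfolding Suc.IH[symmetric] surj[symmetric] by blast
        then have "d = h (commutator G g k)" by (simp add: hom_commutator G.lower_central_carrier)
        then show "d \<in> h ` ?C" using \<open>g \<in> carrier G\<close> \<open>k \<in> lower_central G n\<close> by blast
      qed
    qed
    moreover have "?C \<subseteq> carrier G" by (auto simp: G.lower_central_carrier)
    ultimately show ?thesis
      using False generate_img[of ?C] by (simp add: lower_central_Suc)
  qed
qed


section \<open>The Andreadakis filtration\<close>

context group
begin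

lemma AutoGroup_mult [simp]:
  assumes "\<phi> \<in> carrier (AutoGroup G)" "\<psi> \<in> carrier (AutoGroup G)"
  shows "\<phi> \<otimes>\<^bsub>AutoGroup G\<^esub> \<psi> = compose (carrier G) \<phi> \<psi>"
  using assms by (simp add: AutoGroup_def BijGroup_def auto_def)

lemma AutoGroup_one: "\<one>\<^bsub>AutoGroup G\<^esub> = (\<lambda>x \<in> carrier G. x)"
  by (simp add: AutoGroup_def BijGroup_def)

lemma AutoGroup_group_hom: "\<phi> \<in> carrier (AutoGroup G) \<Longrightarrow> group_hom G G \<phi>"
  by (simp add: AutoGroup_def auto_def group_hom_def group_hom_axioms_def)

lemma AutoGroup_closed [simp]:
  "\<lbrakk>\<phi> \<in> carrier (AutoGroup G); x \<in> carrier G\<rbrakk> \<Longrightarrow> \<phi> x \<in> carrier G"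
  by (rule group_hom.hom_closed[OF AutoGroup_group_hom])

lemma AutoGroup_img:
  assumes "\<phi> \<in> carrier (AutoGroup G)"
  shows "\<phi> ` carrier G = carrier G"
  using assms by (simp add: AutoGroup_def auto_def Bij_def bij_betw_def)

text \<open>An automorphism is a surjective endomorphism. Equality, rather than inclusion, lets
  every element of a term be written as the image of an element of the same term.\<close>

lemma AutoGroup_lower_central:
  "\<phi> \<in> carrier (AutoGroup G) \<Longrightarrow> \<phi> ` lower_central G n = lower_central G n"
  using group_hom.lower_central_img[OF AutoGroup_group_hom AutoGroup_img] .

lemma AutoGroup_lower_centralD:
  "\<lbrakk>\<phi> \<in> carrier (AutoGroup G); x \<in> lower_central G n\<rbrakk> \<Longrightarrow> \<phi> x \<in> lower_central G n"
  using AutoGroup_lower_central by blast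

lemma andreadakis_carrier: "\<phi> \<in> andreadakis G j \<Longrightarrow> \<phi> \<in> carrier (AutoGroup G)"
  by (simp add: andreadakis_def)

lemma andreadakisD:
  "\<lbrakk>\<phi> \<in> andreadakis G j; i \<ge> 1; x \<in> lower_central G i\<rbrakk> \<Longrightarrow>
   \<phi> x \<otimes> inv x \<in> lower_central G (i + j)"
  by (simp add: andreadakis_def)

text \<open>The displacement of a product at g telescopes through \<open>\<psi> g\<close>. The
  displacement of the inverse of \<phi> at g is the inverse of the displacement of \<phi> at the
  preimage of g. Automorphisms preserve each term, so both lie in term i + j.\<close>

lemma andreadakis_subgroup: "subgroup (andreadakis G j) (AutoGroup G)"
proof -
  interpret A: group "AutoGroup G" by (rule AutoGroup)
  show ?thesis
  proof (rule A.subgroupI)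
    show "andreadakis G j \<subseteq> carrier (AutoGroup G)" by (auto simp: andreadakis_def)
    have "\<one>\<^bsub>AutoGroup G\<^esub> \<in> andreadakis G j"
      by (auto simp: andreadakis_def simp flip: AutoGroup_one)
        (auto simp: AutoGroup_one lower_central_carrier)
    then show "andreadakis G j \<noteq> {}" by blast
  next
    fix \<phi> assume \<phi>: "\<phi> \<in> andreadakis G j"
    note \<phi>A = andreadakis_carrier[OF \<phi>]
    have "(inv\<^bsub>AutoGroup G\<^esub> \<phi>) g \<otimes> inv g \<in> lower_central G (i + j)"
      if i: "i \<ge> 1" and g: "g \<in> lower_central G i" for i g
    proof -
      let ?h = "(inv\<^bsub>AutoGroup G\<^esub> \<phi>) g"
      have h: "?h \<in> lower_central G i" using AutoGroup_lower_centralD[OF _ g] \<phi>A by simp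
      have "(\<phi> \<otimes>\<^bsub>AutoGroup G\<^esub> inv\<^bsub>AutoGroup G\<^esub> \<phi>) g = g"
        using \<phi>A g by (simp add: AutoGroup_one lower_central_carrier del: AutoGroup_mult)
      then have "\<phi> ?h = g" using \<phi>A g by (simp add: compose_def lower_central_carrier)
      then have "inv (g \<otimes> inv ?h) \<in> lower_central G (i + j)"
        using lower_central_inv[OF andreadakisD[OF \<phi> i h]] by simp
      then show ?thesis using g h by (simp add: inv_mult_group lower_central_carrier)
    qed
    then show "inv\<^bsub>AutoGroup G\<^esub> \<phi> \<in> andreadakis G j" using \<phi>A by (simp add: andreadakis_def)
  next
    fix \<phi> \<psi> assume \<phi>: "\<phi> \<in> andreadakis G j" and \<psi>: "\<psi> \<in> andreadakis G j"
    note \<phi>A = andreadakis_carrier[OF \<phi>] and \<psi>A = andreadakis_carrier[OF \<psi>]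
    interpret \<phi>: group_hom G G \<phi> by (rule AutoGroup_group_hom[OF \<phi>A])
    have "(\<phi> \<otimes>\<^bsub>AutoGroup G\<^esub> \<psi>) g \<otimes> inv g \<in> lower_central G (i + j)"
      if i: "i \<ge> 1" and g: "g \<in> lower_central G i" for i g
    proof -
      have gc: "g \<in> carrier G" using g by (rule lower_central_carrier)
      have "(\<phi> \<otimes>\<^bsub>AutoGroup G\<^esub> \<psi>) g \<otimes> inv g = (\<phi> (\<psi> g) \<otimes> inv (\<psi> g)) \<otimes> (\<psi> g \<otimes> inv g)"
        using \<phi>A \<psi>A gc by (simp add: compose_def m_assoc)
      then show ?thesis
        using andreadakisD[OF \<phi> i AutoGroup_lower_centralD[OF \<psi>A g]] andreadakisD[OF \<psi> i g]
        by (simp add: lower_central_mult)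
    qed
    moreover have "\<phi> \<otimes>\<^bsub>AutoGroup G\<^esub> \<psi> \<in> carrier (AutoGroup G)"
      using \<phi>A \<psi>A by (simp del: AutoGroup_mult)
    ultimately show "\<phi> \<otimes>\<^bsub>AutoGroup G\<^esub> \<psi> \<in> andreadakis G j"
      by (simp add: andreadakis_def del: AutoGroup_mult)
  qed
qed

text \<open>Comparing \<phi>\<psi> with \<psi>\<phi> at the same point leaves only error terms of
  degree i + j + 1.\<close>

lemma andreadakis_commutator:
  assumes \<phi>: "\<phi> \<in> andreadakis G 1" and \<psi>: "\<psi> \<in> andreadakis G j"
  shows "commutator (AutoGroup G) \<phi> \<psi> \<in> andreadakis G (Suc j)"
proof -
  interpret A: group "AutoGroup G" by (rule AutoGroup)
  note \<phi>A = andreadakis_carrier[OF \<phi>] and \<psi>A = andreadakis_carrier[OF \<psi>]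
  interpret \<phi>: group_hom G G \<phi> by (rule AutoGroup_group_hom[OF \<phi>A])
  interpret \<psi>: group_hom G G \<psi> by (rule AutoGroup_group_hom[OF \<psi>A])
  let ?\<chi> = "commutator (AutoGroup G) \<phi> \<psi>"
  have \<chi>A: "?\<chi> \<in> carrier (AutoGroup G)" using \<phi>A \<psi>A by (simp del: AutoGroup_mult)
  have \<psi>\<phi>A: "\<psi> \<otimes>\<^bsub>AutoGroup G\<^esub> \<phi> \<in> carrier (AutoGroup G)"
    using \<phi>A \<psi>A by (simp del: AutoGroup_mult)
  have "?\<chi> g \<otimes> inv g \<in> lower_central G (i + Suc j)"
    if i: "i \<ge> 1" and g: "g \<in> lower_central G i" for i g
  proof -
    \<comment> \<open>With g written as the image of h under \<psi>\<phi>, the value of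
      \<open>?\<chi>\<close> at g is simply \<open>\<phi> (\<psi> h)\<close>.\<close>
    obtain h where h: "h \<in> lower_central G i" and "g = (\<psi> \<otimes>\<^bsub>AutoGroup G\<^esub> \<phi>) h"
      using AutoGroup_lower_central[OF \<psi>\<phi>A] g by blast
    have hc: "h \<in> carrier G" using h by (rule lower_central_carrier)
    have g_eq: "g = \<psi> (\<phi> h)"
      using \<open>g = (\<psi> \<otimes>\<^bsub>AutoGroup G\<^esub> \<phi>) h\<close> hc \<phi>A \<psi>A by (simp add: compose_def)
    have "?\<chi> g = (?\<chi> \<otimes>\<^bsub>AutoGroup G\<^esub> (\<psi> \<otimes>\<^bsub>AutoGroup G\<^esub> \<phi>)) h"
      unfolding \<open>g = (\<psi> \<otimes>\<^bsub>AutoGroup G\<^esub> \<phi>) h\<close> AutoGroup_mult[OF \<chi>A \<psi>\<phi>A]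
      using hc by (simp add: compose_def)
    also have "\<dots> = (\<phi> \<otimes>\<^bsub>AutoGroup G\<^esub> \<psi>) h"
      using A.commutator_mult_swap[OF \<phi>A \<psi>A] by simp
    also have "\<dots> = \<phi> (\<psi> h)" using hc \<phi>A \<psi>A by (simp add: compose_def)
    finally have \<chi>g: "?\<chi> g = \<phi> (\<psi> h)" .
    \<comment> \<open>First and second displacements: a and b are those of h; u is that of b under
      \<phi>, and v that of a under \<psi>. Both u and v have gained the shift 1 as well as the
      shift j.\<close>
    define a where "a = \<phi> h \<otimes> inv h"
    define b where "b = \<psi> h \<otimes> inv h"
    define u where "u = \<phi> b \<otimes> inv b"
    define v where "v = \<psi> a \<otimes> inv a"
    have a: "a \<in> lower_central G (i + 1)" unfolding a_def by (rule andreadakisD[OF \<phi> i h])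
    have b: "b \<in> lower_central G (i + j)" unfolding b_def by (rule andreadakisD[OF \<psi> i h])
    have u: "u \<in> lower_central G (i + Suc j)"
      unfolding u_def using andreadakisD[OF \<phi> _ b] i by simp
    have v: "v \<in> lower_central G (i + Suc j)"
      unfolding v_def using andreadakisD[OF \<psi> _ a] i by simp
    have carr: "a \<in> carrier G" "b \<in> carrier G" "u \<in> carrier G" "v \<in> carrier G"
      using a b u v by (auto simp: lower_central_carrier)
    have eqs: "\<phi> h = a \<otimes> h" "\<psi> h = b \<otimes> h" "\<phi> b = u \<otimes> b" "\<psi> a = v \<otimes> a"
      using hc carr by (auto simp: a_def b_def u_def v_def m_assoc)
    have "?\<chi> g \<otimes> inv g = \<phi> (\<psi> h) \<otimes> inv (\<psi> (\<phi> h))" unfolding \<chi>g by (simp only: g_eq)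
    \<comment> \<open>Here \<open>\<phi> (\<psi> h)\<close> is the word u b a h and
      \<open>\<psi> (\<phi> h)\<close> is v a b h, so h cancels in the quotient.\<close>
    also have "\<dots> = u \<otimes> commutator G b a \<otimes> inv v"
      using hc carr by (simp add: eqs commutator_def inv_mult_group m_assoc)
    finally have "?\<chi> g \<otimes> inv g = u \<otimes> commutator G b a \<otimes> inv v" .
    moreover have "commutator G b a \<in> lower_central G (i + Suc j)"
      using commutator_lower_central'[OF _ carr(1) b] i by simp
    ultimately show ?thesis using u v by (simp add: lower_central_mult lower_central_inv)
  qed
  then show ?thesis using \<chi>A by (simp add: andreadakis_def)
qed

text \<open>Induction on j: generators of the next term are commutators of an element of
  \<open>IA G\<close> with an element of the j-th filtration term, and
  \<open>andreadakis_commutator\<close> applies to them.\<close>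

lemma IA_lower_central_subset:
  assumes "j \<ge> 1"
  shows "lower_central (AutoGroup G\<lparr>carrier := IA G\<rparr>) j \<subseteq> andreadakis G j"
  using assms
proof (induction j rule: dec_induct)
  case base
  show ?case by (simp add: IA_def)
next
  case (step j)
  interpret A: group "AutoGroup G" by (rule AutoGroup)
  have sub: "subgroup (IA G) (AutoGroup G)"
    unfolding IA_def by (rule andreadakis_subgroup)
  let ?K = "AutoGroup G\<lparr>carrier := IA G\<rparr>"
  interpret K: group ?K using A.subgroup_imp_group[OF sub] .
  have comm: "commutator ?K \<phi> \<psi> = commutator (AutoGroup G) \<phi> \<psi>"
    if "\<phi> \<in> IA G" "\<psi> \<in> IA G" for \<phi> \<psi>
    using that A.m_inv_consistent[OF sub] by (simp add: commutator_def)
  \<comment> \<open>Intersecting with \<open>IA G\<close> makes the target a subgroup of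
    \<open>?K\<close>, the group in which the generated subgroup is formed.\<close>
  have "{commutator ?K \<phi> \<psi> | \<phi> \<psi>. \<phi> \<in> carrier ?K \<and> \<psi> \<in> lower_central ?K j}
      \<subseteq> andreadakis G (Suc j) \<inter> IA G"
  proof clarify
    fix \<phi> \<psi> assume \<phi>: "\<phi> \<in> carrier ?K" and \<psi>: "\<psi> \<in> lower_central ?K j"
    have "\<psi> \<in> IA G" using K.lower_central_carrier[OF \<psi>] by simp
    moreover have "\<psi> \<in> andreadakis G j" using \<psi> step.IH by blast
    moreover have "commutator ?K \<phi> \<psi> \<in> IA G"
      using K.commutator_closed[OF \<phi> K.lower_central_carrier[OF \<psi>]] by simp
    ultimately show "commutator ?K \<phi> \<psi> \<in> andreadakis G (Suc j) \<inter> IA G"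
      using comm[of \<phi> \<psi>] \<phi> andreadakis_commutator[of \<phi> \<psi> j] by (simp add: IA_def)
  qed
  moreover have "subgroup (andreadakis G (Suc j) \<inter> IA G) ?K"
    by (rule A.subgroup_incl[OF A.subgroups_Inter_pair[OF andreadakis_subgroup sub] sub]) simp
  ultimately show ?case
    using K.generate_subgroup_incl step.hyps(1) by (subst lower_central_Suc) blast+
qed

end


section \<open>Inner automorphisms\<close>

definition inner_aut :: "('a, 'm) monoid_scheme \<Rightarrow> 'a \<Rightarrow> 'a \<Rightarrow> 'a" where
  "inner_aut G g = (\<lambda>x \<in> carrier G. g \<otimes>\<^bsub>G\<^esub> x \<otimes>\<^bsub>G\<^esub> inv\<^bsub>G\<^esub> g)"

text \<open>The preimage of \<open>andreadakis G j\<close> under conjugation, phrased with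
  commutators so that it can be compared with the Lie bracket.\<close>

definition degree_raising :: "('a, 'm) monoid_scheme \<Rightarrow> nat \<Rightarrow> 'a set" where
  "degree_raising G j = {g \<in> carrier G. \<forall>i \<ge> 1. \<forall>x \<in> lower_central G i.
     commutator G g x \<in> lower_central G (i + j)}"

lemma Inn_eq: "Inn G = inner_aut G ` carrier G"
  by (simp add: Inn_def inner_aut_def)

context group
begin

lemma inner_aut_closed:
  assumes g: "g \<in> carrier G"
  shows "inner_aut G g \<in> carrier (AutoGroup G)"
proof -
  have "bij_betw (inner_aut G g) (carrier G) (carrier G)"
    using g by (intro bij_betw_byWitness[where f' = "inner_aut G (inv g)"])
      (auto simp: inner_aut_def m_assoc)
  moreover have "inner_aut G g \<in> hom G G"
    using g by (intro homI) (auto simp: inner_aut_def m_assoc)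
  ultimately show ?thesis
    by (simp add: AutoGroup_def auto_def Bij_def inner_aut_def)
qed

lemma inner_aut_group_hom: "group_hom G (AutoGroup G) (inner_aut G)"
proof -
  have "inner_aut G (g \<otimes> h) = inner_aut G g \<otimes>\<^bsub>AutoGroup G\<^esub> inner_aut G h"
    if "g \<in> carrier G" "h \<in> carrier G" for g h
  proof -
    have "inner_aut G (g \<otimes> h) = compose (carrier G) (inner_aut G g) (inner_aut G h)"
      using that by (auto simp: inner_aut_def compose_def inv_mult_group m_assoc)
    then show ?thesis using that by (simp add: inner_aut_closed)
  qed
  then have "inner_aut G \<in> hom G (AutoGroup G)"
    by (intro homI) (simp_all add: inner_aut_closed del: AutoGroup_mult)
  then show ?thesis
    by (simp add: group_hom_def group_hom_axioms_def AutoGroup is_group)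
qed

text \<open>The displacement of x under conjugation by g is literally
  \<open>commutator G g x\<close>.\<close>

lemma inner_aut_andreadakis_iff:
  "g \<in> carrier G \<Longrightarrow> inner_aut G g \<in> andreadakis G j \<longleftrightarrow> g \<in> degree_raising G j"
  by (auto simp: andreadakis_def degree_raising_def inner_aut_closed)
    (auto simp: inner_aut_def commutator_def lower_central_carrier)

lemma degree_raising_carrier: "g \<in> degree_raising G j \<Longrightarrow> g \<in> carrier G"
  by (simp add: degree_raising_def)

text \<open>This is the preimage of a subgroup under the homomorphism \<open>inner_aut G\<close>;
  each closure property is transported through \<open>inner_aut_andreadakis_iff\<close>.\<close>

lemma degree_raising_subgroup: "subgroup (degree_raising G j) G"
proof -
  interpret I: group_hom G "AutoGroup G" "inner_aut G" by (rule inner_aut_group_hom)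
  note A = andreadakis_subgroup[of j]
  show ?thesis
  proof (rule subgroupI)
    show "degree_raising G j \<subseteq> carrier G" by (auto simp: degree_raising_def)
    have "\<one> \<in> degree_raising G j"
      using subgroup.one_closed[OF A] by (simp flip: inner_aut_andreadakis_iff)
    then show "degree_raising G j \<noteq> {}" by blast
  next
    fix g assume g: "g \<in> degree_raising G j"
    note gc = degree_raising_carrier[OF g]
    from g show "inv g \<in> degree_raising G j"
      using subgroup.m_inv_closed[OF A] gc by (simp flip: inner_aut_andreadakis_iff)
  next
    fix g h assume g: "g \<in> degree_raising G j" and h: "h \<in> degree_raising G j"
    note gc = degree_raising_carrier[OF g] and hc = degree_raising_carrier[OF h]
    from g h show "g \<otimes> h \<in> degree_raising G j"
      using subgroup.m_closed[OF A] gc hc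
      by (simp flip: inner_aut_andreadakis_iff del: AutoGroup_mult)
  qed
qed

lemma degree_raising_Suc_subset: "degree_raising G (Suc j) \<subseteq> degree_raising G j"
proof
  fix g assume g: "g \<in> degree_raising G (Suc j)"
  have "commutator G g x \<in> lower_central G (i + j)"
    if "i \<ge> 1" "x \<in> lower_central G i" for i x
    using that g lower_central_Suc_subset[of "i + j"] by (auto simp: degree_raising_def)
  then show "g \<in> degree_raising G j" using g by (simp add: degree_raising_def)
qed

lemma degree_raising_one: "degree_raising G 1 = carrier G"
  by (auto simp: degree_raising_def commutator_lower_central)

section \<open>The group of inner automorphisms and its lower central series\<close>

lemma Inn_subgroup: "subgroup (Inn G) (AutoGroup G)"
  unfolding Inn_eq using group_hom.img_is_subgroup[OF inner_aut_group_hom] .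

lemma Inn_subset_IA: "Inn G \<subseteq> IA G"
proof -
  have "\<And>g. g \<in> carrier G \<Longrightarrow> inner_aut G g \<in> andreadakis G 1"
    by (simp only: inner_aut_andreadakis_iff degree_raising_one)
  then show ?thesis by (auto simp: Inn_eq IA_def)
qed

lemma lower_central_Inn:
  "lower_central (AutoGroup G\<lparr>carrier := Inn G\<rparr>) j = inner_aut G ` lower_central G j"
proof -
  interpret I: group_hom G "AutoGroup G" "inner_aut G" by (rule inner_aut_group_hom)
  interpret K: group "AutoGroup G\<lparr>carrier := Inn G\<rparr>"
    using I.H.subgroup_imp_group[OF Inn_subgroup] .
  \<comment> \<open>Cutting the codomain down to \<open>Inn G\<close> makes conjugation surjective,
    so that it carries lower central terms onto lower central terms.\<close>
  interpret J: group_hom G "AutoGroup G\<lparr>carrier := Inn G\<rparr>" "inner_aut G"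
    by unfold_locales (use I.homh in \<open>auto simp: hom_def Inn_eq\<close>)
  show ?thesis by (rule J.lower_central_img[symmetric]) (simp add: Inn_eq)
qed

lemma lower_central_IA_mono:
  assumes "subgroup K (AutoGroup G)" "K \<subseteq> IA G"
  shows "lower_central (AutoGroup G\<lparr>carrier := K\<rparr>) j
    \<subseteq> lower_central (AutoGroup G\<lparr>carrier := IA G\<rparr>) j"
proof -
  interpret A: group "AutoGroup G" by (rule AutoGroup)
  have sub: "subgroup (IA G) (AutoGroup G)"
    unfolding IA_def by (rule andreadakis_subgroup)
  interpret I: group "AutoGroup G\<lparr>carrier := IA G\<rparr>" by (rule A.subgroup_imp_group[OF sub])
  interpret K: group "AutoGroup G\<lparr>carrier := K\<rparr>" by (rule A.subgroup_imp_group[OF assms(1)])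
  interpret J: group_hom "AutoGroup G\<lparr>carrier := K\<rparr>" "AutoGroup G\<lparr>carrier := IA G\<rparr>" "\<lambda>x. x"
    by unfold_locales (use assms in \<open>auto simp: hom_def\<close>)
  show ?thesis using J.lower_central_img_subset[of j] by simp
qed

text \<open>
  No three subgroups lemma is needed: \<open>\<Gamma>\<^sub>i\<close> acts by conjugation through
  \<open>\<Gamma>\<^sub>i(IA G)\<close>, which lies in the \<open>i\<close>-th term of the Andreadakis filtration.
\<close>

lemma lower_central_degree_raising:
  assumes "j \<ge> 1"
  shows "lower_central G j \<subseteq> degree_raising G j"
proof
  fix g assume g: "g \<in> lower_central G j"
  have "inner_aut G g \<in> lower_central (AutoGroup G\<lparr>carrier := IA G\<rparr>) j"
    using g lower_central_IA_mono[OF Inn_subgroup Inn_subset_IA, of j]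
    by (auto simp: lower_central_Inn)
  then show "g \<in> degree_raising G j"
    using IA_lower_central_subset[OF assms] inner_aut_andreadakis_iff[of g j]
      lower_central_carrier[OF g] by blast
qed

text \<open>Elements of term i raise every degree by i. It follows that the bracket of classes of
  degrees i and j lands in degree i + j and is independent of representatives.\<close>

lemma commutator_lower_central_add:
  "\<lbrakk>i \<ge> 1; j \<ge> 1; x \<in> lower_central G i; y \<in> lower_central G j\<rbrakk> \<Longrightarrow>
   commutator G x y \<in> lower_central G (i + j)"
  using lower_central_degree_raising[of i]
  unfolding degree_raising_def by (subst add.commute) blast

section \<open>The center and the Andreadakis equality for inner automorphisms\<close>

lemma group_center_carrier: "z \<in> group_center G \<Longrightarrow> z \<in> carrier G"
  by (simp add: group_center_def)

lemma group_centerD: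
  "\<lbrakk>z \<in> group_center G; g \<in> carrier G\<rbrakk> \<Longrightarrow> z \<otimes> g = g \<otimes> z"
  by (simp add: group_center_def)

lemma inner_aut_eq_iff:
  assumes "g \<in> carrier G" "h \<in> carrier G"
  shows "inner_aut G g = inner_aut G h \<longleftrightarrow> inv h \<otimes> g \<in> group_center G"
proof
  assume eq: "inner_aut G g = inner_aut G h"
  have "inv h \<otimes> g \<otimes> x = x \<otimes> (inv h \<otimes> g)" if x: "x \<in> carrier G" for x
  proof -
    have "g \<otimes> x \<otimes> inv g = h \<otimes> x \<otimes> inv h"
      using fun_cong[OF eq, of x] x by (simp add: inner_aut_def)
    then have "inv h \<otimes> (g \<otimes> x \<otimes> inv g) \<otimes> g = inv h \<otimes> (h \<otimes> x \<otimes> inv h) \<otimes> g" by simp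
    then show ?thesis using assms x by (simp add: m_assoc)
  qed
  then show "inv h \<otimes> g \<in> group_center G" using assms by (simp add: group_center_def)
next
  assume z: "inv h \<otimes> g \<in> group_center G"
  have "g \<otimes> x \<otimes> inv g = h \<otimes> x \<otimes> inv h" if x: "x \<in> carrier G" for x
  proof -
    have "h \<otimes> (inv h \<otimes> g \<otimes> x) \<otimes> inv g = h \<otimes> (x \<otimes> (inv h \<otimes> g)) \<otimes> inv g"
      using group_centerD[OF z x] by simp
    then show ?thesis using assms x by (simp add: m_assoc)
  qed
  then show "inner_aut G g = inner_aut G h" by (auto simp: inner_aut_def)
qed

text \<open>An element can therefore be multiplied by central elements without changing how far it
  raises degrees.\<close>

lemma group_center_subset_degree_raising: "group_center G \<subseteq> degree_raising G j"
proof
  fix z assume z: "z \<in> group_center G"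
  have "commutator G z x = \<one>" if "x \<in> carrier G" for x
    using group_centerD[OF z that] group_center_carrier[OF z] that
    by (simp add: commutator_def m_assoc)
  then show "z \<in> degree_raising G j"
    using z by (simp add: degree_raising_def group_center_carrier lower_central_carrier)
qed

lemma group_center_normal: "group_center G \<lhd> G"
proof -
  have "subgroup (group_center G) G"
  proof (rule subgroupI)
    show "group_center G \<noteq> {}" by (force simp: group_center_def)
  next
    fix z assume z: "z \<in> group_center G"
    have "inv z \<otimes> g = g \<otimes> inv z" if g: "g \<in> carrier G" for g
    proof -
      have "inv z \<otimes> (g \<otimes> z) \<otimes> inv z = inv z \<otimes> (z \<otimes> g) \<otimes> inv z"
        using group_centerD[OF z g] by simp
      then show ?thesis using g group_center_carrier[OF z] by (simp add: m_assoc)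
    qed
    then show "inv z \<in> group_center G" using z by (simp add: group_center_def)
  next
    fix y z assume y: "y \<in> group_center G" and z: "z \<in> group_center G"
    have "y \<otimes> z \<otimes> g = g \<otimes> (y \<otimes> z)" if g: "g \<in> carrier G" for g
    proof -
      have "y \<otimes> z \<otimes> g = y \<otimes> g \<otimes> z"
        using g y z by (simp add: m_assoc group_centerD[OF z] group_center_carrier)
      also have "\<dots> = g \<otimes> (y \<otimes> z)"
        using g y z by (simp add: m_assoc group_centerD[OF y] group_center_carrier)
      finally show ?thesis .
    qed
    moreover have "y \<otimes> z \<in> carrier G" using y z by (simp add: group_center_carrier)
    ultimately show "y \<otimes> z \<in> group_center G" by (simp add: group_center_def)
  qed (auto simp: group_center_def)
  moreover have "g \<otimes> z \<otimes> inv g \<in> group_center G"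
    if z: "z \<in> group_center G" and g: "g \<in> carrier G" for z g
  proof -
    have "g \<otimes> z \<otimes> inv g = z"
      using g group_center_carrier[OF z] by (simp add: m_assoc flip: group_centerD[OF z g])
    then show ?thesis using z by simp
  qed
  ultimately show ?thesis by (rule normal_invI)
qed

text \<open>The inclusions \<open>sub\<close> always hold, so both equalities for j amount to the
  inclusion of the last set in the first. Pulled back along conjugation, this says that an element
  raising degrees by j agrees with an element of term j up to the center.\<close>

lemma andreadakis_equality_Inn_iff:
  "andreadakis_equality G (Inn G) \<longleftrightarrow>
    (\<forall>j \<ge> 1. \<forall>g \<in> degree_raising G j. \<exists>h \<in> lower_central G j. inv h \<otimes> g \<in> group_center G)"
  (is "_ \<longleftrightarrow> ?R")
proof -
  have sub: "inner_aut G ` lower_central G j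
        \<subseteq> Inn G \<inter> lower_central (AutoGroup G\<lparr>carrier := IA G\<rparr>) j"
      "Inn G \<inter> lower_central (AutoGroup G\<lparr>carrier := IA G\<rparr>) j \<subseteq> Inn G \<inter> andreadakis G j"
    if "j \<ge> 1" for j
    using that lower_central_IA_mono[OF Inn_subgroup Inn_subset_IA, of j] IA_lower_central_subset
    unfolding lower_central_Inn by (auto simp: Inn_eq lower_central_carrier)
  have "andreadakis_equality G (Inn G) \<longleftrightarrow>
      (\<forall>j \<ge> 1. Inn G \<inter> andreadakis G j \<subseteq> inner_aut G ` lower_central G j)"
    using sub unfolding andreadakis_equality_def lower_central_Inn
    by (simp add: Inn_subgroup Inn_subset_IA set_eq_subset) blast
  also have "\<dots> \<longleftrightarrow> ?R"
  proof -
    have "inner_aut G g \<in> inner_aut G ` lower_central G j \<longleftrightarrow>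
        (\<exists>h \<in> lower_central G j. inv h \<otimes> g \<in> group_center G)" if "g \<in> carrier G" for g j
      using that by (auto simp: image_iff inner_aut_eq_iff lower_central_carrier)
    moreover have "Inn G \<inter> andreadakis G j = inner_aut G ` degree_raising G j" for j
      using degree_raising_carrier by (auto simp: Inn_eq inner_aut_andreadakis_iff)
    ultimately show ?thesis using degree_raising_carrier by (simp add: image_subset_iff)
  qed
  finally show ?thesis .
qed

text \<open>From left to right, the equality in degree i + 1 provides h, and the central quotient
  \<open>inv h \<otimes> g\<close> is the required z. Conversely, an approximation of g in term j is
  moved into term j + 1 by dividing it by a central element.\<close>

lemma andreadakis_equality_Inn_graded_iff:
  "andreadakis_equality G (Inn G) \<longleftrightarrow>
    (\<forall>i \<ge> 1. \<forall>g \<in> lower_central G i \<inter> degree_raising G (Suc i).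
       \<exists>z \<in> group_center G \<inter> lower_central G i. g \<otimes> inv z \<in> lower_central G (Suc i))"
  (is "_ \<longleftrightarrow> ?R")
proof
  assume A: "andreadakis_equality G (Inn G)"
  show ?R
  proof (intro allI impI ballI)
    fix i g assume i: "i \<ge> (1::nat)" and "g \<in> lower_central G i \<inter> degree_raising G (Suc i)"
    then have g: "g \<in> lower_central G i" "g \<in> degree_raising G (Suc i)" by auto
    obtain h where h: "h \<in> lower_central G (Suc i)" "inv h \<otimes> g \<in> group_center G"
      using A[unfolded andreadakis_equality_Inn_iff, rule_format, of "Suc i" g] g(2) by auto
    have "h \<in> lower_central G i" using h(1) lower_central_Suc_subset by blast
    then have "inv h \<otimes> g \<in> lower_central G i"
      using g by (simp add: lower_central_mult lower_central_inv)
    moreover have "g \<otimes> inv (inv h \<otimes> g) = h"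
      using g h by (simp add: lower_central_carrier inv_mult_group)
    ultimately show "\<exists>z \<in> group_center G \<inter> lower_central G i. g \<otimes> inv z \<in> lower_central G (Suc i)"
      using h by (intro bexI[of _ "inv h \<otimes> g"]) auto
  qed
next
  assume R: ?R
  interpret Z: normal "group_center G" G by (rule group_center_normal)
  have "\<exists>h \<in> lower_central G j. inv h \<otimes> g \<in> group_center G"
    if "j \<ge> 1" "g \<in> degree_raising G j" for j g
    using that
  proof (induction j arbitrary: g rule: dec_induct)
    case base
    then have "g \<in> lower_central G 1" "inv g \<otimes> g \<in> group_center G"
      by (simp_all add: degree_raising_carrier)
    then show ?case by blast
  next
    case (step j)
    interpret D: subgroup "degree_raising G (Suc j)" G by (rule degree_raising_subgroup)
    have "g \<in> degree_raising G j"
      using step.prems degree_raising_Suc_subset by blast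
    then obtain h where h: "h \<in> lower_central G j" "inv h \<otimes> g \<in> group_center G"
      using step.IH by blast
    note hc = lower_central_carrier[OF h(1)] and gc = degree_raising_carrier[OF step.prems]
    \<comment> \<open>Dividing g by a central element yields h, so h raises degrees as far as g does
      and the graded condition applies to h.\<close>
    have "g \<otimes> inv (inv h \<otimes> g) \<in> degree_raising G (Suc j)"
      using D.m_closed[OF step.prems D.m_inv_closed] h(2) group_center_subset_degree_raising
      by blast
    then have "h \<in> degree_raising G (Suc j)" using hc gc by (simp add: inv_mult_group)
    then obtain z where z: "z \<in> group_center G" "h \<otimes> inv z \<in> lower_central G (Suc j)"
      using R[rule_format, of j h] step.hyps(1) h(1) by auto
    \<comment> \<open>The new approximation is \<open>h \<otimes> inv z\<close>; its discrepancy
      from g changes only by the central factor z.\<close>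
    have "inv (h \<otimes> inv z) \<otimes> g = z \<otimes> (inv h \<otimes> g)"
      using hc gc z(1) by (simp add: inv_mult_group m_assoc group_center_carrier)
    then have "inv (h \<otimes> inv z) \<otimes> g \<in> group_center G" using z(1) h(2) by simp
    then show ?case using z(2) by blast
  qed
  then show "andreadakis_equality G (Inn G)" by (simp add: andreadakis_equality_Inn_iff)
qed

end


section \<open>The graded pieces\<close>

definition gr_class :: "('a, 'm) monoid_scheme \<Rightarrow> nat \<Rightarrow> 'a \<Rightarrow> 'a set" where
  "gr_class G i g = lower_central G (Suc i) #>\<^bsub>G\<^esub> g"

lemma carrier_gr: "carrier (gr G i) = gr_class G i ` lower_central G i"
  by (simp add: gr_def gr_class_def carrier_FactGroup)

lemma one_gr: "\<one>\<^bsub>gr G i\<^esub> = lower_central G (Suc i)"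
  by (simp add: gr_def)

text \<open>For infinite \<open>A\<close> both products are the unit by convention, so the induction
  covers every index set.\<close>

lemma (in comm_group) finprod_hom:
  assumes "group_hom G H h" "comm_group H" "f \<in> A \<rightarrow> carrier G"
  shows "h (finprod G f A) = finprod H (\<lambda>x. h (f x)) A"
proof -
  interpret h: group_hom G H h by fact
  interpret H: comm_group H by fact
  show ?thesis
    using assms(3) by (induction A rule: infinite_finite_induct) (auto simp: Pi_iff)
qed

context group
begin

lemma gr_classI: "g \<in> lower_central G i \<Longrightarrow> gr_class G i g \<in> carrier (gr G i)"
  by (simp add: carrier_gr)

lemma gr_class_mult:
  "\<lbrakk>a \<in> carrier G; b \<in> carrier G\<rbrakk> \<Longrightarrow>
   gr_class G i (a \<otimes> b) = gr_class G i a \<otimes>\<^bsub>gr G i\<^esub> gr_class G i b"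
  using normal.rcos_sum[OF lower_central_normal, of a b "Suc i"]
  by (simp add: gr_def gr_class_def)

lemma gr_class_eq_iff:
  assumes "a \<in> carrier G" "b \<in> carrier G"
  shows "gr_class G i a = gr_class G i b \<longleftrightarrow> a \<otimes> inv b \<in> lower_central G (Suc i)"
  using assms subgroup.rcos_module[OF lower_central_subgroup is_group assms(2,1), of "Suc i"]
    rcos_self[OF assms(1) lower_central_subgroup, of "Suc i"]
    repr_independence[OF _ assms(2) lower_central_subgroup, of a "Suc i"]
  unfolding gr_class_def by metis

text \<open>Guarantees that the unions in \<open>gr_bracket\<close> and \<open>gr_map\<close> run
  over representatives of the same degree and the same class.\<close>

lemma gr_class_memD:
  assumes "a' \<in> gr_class G i a" "a \<in> lower_central G i"
  shows "a' \<in> lower_central G i" "gr_class G i a' = gr_class G i a"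
proof -
  obtain c where c: "c \<in> lower_central G (Suc i)" "a' = c \<otimes> a"
    using assms(1) by (auto simp: gr_class_def r_coset_def)
  show a': "a' \<in> lower_central G i"
    using c assms(2) lower_central_Suc_subset by (auto intro: lower_central_mult)
  have "a' \<otimes> inv a = c"
    using c assms(2) by (simp add: m_assoc lower_central_carrier)
  then show "gr_class G i a' = gr_class G i a"
    using c(1) gr_class_eq_iff[of a' a] lower_central_carrier[OF a'] lower_central_carrier[OF assms(2)]
    by simp
qed

lemma gr_class_self: "a \<in> lower_central G i \<Longrightarrow> a \<in> gr_class G i a"
  unfolding gr_class_def by (intro rcos_self lower_central_subgroup lower_central_carrier)

lemma gr_class_one: "gr_class G i \<one> = \<one>\<^bsub>gr G i\<^esub>"
  by (simp add: gr_class_def one_gr subgroup.subset[OF lower_central_subgroup] del: lower_central.simps)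

lemma gr_class_eq_one_iff:
  "g \<in> carrier G \<Longrightarrow> gr_class G i g = \<one>\<^bsub>gr G i\<^esub> \<longleftrightarrow> g \<in> lower_central G (Suc i)"
  using gr_class_eq_iff[of g \<one> i] by (simp add: gr_class_one)

lemma group_gr: "group (gr G i)"
  unfolding gr_def
  by (intro normal.factorgroup_is_group normal_restrict_supergroup lower_central_subgroup
      lower_central_normal lower_central_Suc_subset)

lemma gr_class_inv:
  assumes "g \<in> lower_central G i"
  shows "gr_class G i (inv g) = inv\<^bsub>gr G i\<^esub> gr_class G i g"
proof -
  interpret gr: group "gr G i" by (rule group_gr)
  have "gr_class G i (inv g) \<otimes>\<^bsub>gr G i\<^esub> gr_class G i g = \<one>\<^bsub>gr G i\<^esub>"
    using assms by (simp add: gr_class_one lower_central_carrier flip: gr_class_mult)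
  then show ?thesis
    using assms gr.inv_equality by (simp add: gr_classI lower_central_inv)
qed

lemma comm_group_gr:
  assumes "i \<ge> 1"
  shows "comm_group (gr G i)"
proof (rule group.group_comm_groupI[OF group_gr])
  fix X Y assume "X \<in> carrier (gr G i)" "Y \<in> carrier (gr G i)"
  then obtain a b where ab: "a \<in> lower_central G i" "b \<in> lower_central G i"
    "X = gr_class G i a" "Y = gr_class G i b"
    by (auto simp: carrier_gr)
  note c = lower_central_carrier[OF ab(1)] lower_central_carrier[OF ab(2)]
  \<comment> \<open>The two products differ by a commutator, which lies one degree higher.\<close>
  have "a \<otimes> b \<otimes> inv (b \<otimes> a) = commutator G a b"
    using c by (simp add: commutator_def inv_mult_group m_assoc)
  then have "gr_class G i (a \<otimes> b) = gr_class G i (b \<otimes> a)"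
    using c commutator_lower_central[OF assms c(1) ab(2)] by (simp add: gr_class_eq_iff)
  then show "X \<otimes>\<^bsub>gr G i\<^esub> Y = Y \<otimes>\<^bsub>gr G i\<^esub> X"
    using c by (simp add: ab gr_class_mult)
qed

text \<open>The nested commutator in \<open>commutator_mult_left\<close> lies in term i + j + 1 and
  so has trivial class; commutativity of the graded piece puts the remaining factors in
  order.\<close>

lemma gr_class_commutator_mult_left:
  assumes "i \<ge> 1" "j \<ge> 1"
    and "x \<in> lower_central G i" "y \<in> lower_central G i" "z \<in> lower_central G j"
  shows "gr_class G (i + j) (commutator G (x \<otimes> y) z)
    = gr_class G (i + j) (commutator G x z) \<otimes>\<^bsub>gr G (i + j)\<^esub> gr_class G (i + j) (commutator G y z)"
proof -
  interpret gr: comm_group "gr G (i + j)" using comm_group_gr assms(1) by simp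
  have c: "x \<in> carrier G" "y \<in> carrier G" "z \<in> carrier G"
    using assms by (auto simp: lower_central_carrier)
  have xz: "commutator G x z \<in> lower_central G (i + j)"
    and yz: "commutator G y z \<in> lower_central G (i + j)"
    using assms by (auto intro: commutator_lower_central_add)
  have "commutator G x (commutator G y z) \<in> lower_central G (Suc (i + j))"
    using commutator_lower_central[OF _ c(1) yz] assms(1) by simp
  then have "gr_class G (i + j) (commutator G x (commutator G y z)) = \<one>\<^bsub>gr G (i + j)\<^esub>"
    using c by (simp add: gr_class_eq_one_iff)
  then show ?thesis
    using c xz yz gr.m_comm
    by (simp add: commutator_mult_left gr_class_mult gr_classI)
qed

lemma gr_class_commutator_swap:
  assumes "i \<ge> 1" "j \<ge> 1" "x \<in> lower_central G i" "y \<in> lower_central G j"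
  shows "gr_class G (i + j) (commutator G y x) = inv\<^bsub>gr G (i + j)\<^esub> gr_class G (i + j) (commutator G x y)"
  using gr_class_inv[OF commutator_lower_central_add[OF assms]] assms
  by (simp add: lower_central_carrier inv_commutator)

text \<open>Write x as d y with d in term i + 1. The commutator of d with z lies in term i + j + 1,
  and additivity removes it.\<close>

lemma gr_class_commutator_cong_left:
  assumes "i \<ge> 1" "j \<ge> 1"
    and "x \<in> lower_central G i" "y \<in> lower_central G i" "z \<in> lower_central G j"
    and eq: "gr_class G i x = gr_class G i y"
  shows "gr_class G (i + j) (commutator G x z) = gr_class G (i + j) (commutator G y z)"
proof -
  interpret gr: group "gr G (i + j)" by (rule group_gr)
  have c: "x \<in> carrier G" "y \<in> carrier G" "z \<in> carrier G"
    using assms by (auto simp: lower_central_carrier)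
  define d where "d = x \<otimes> inv y"
  have d: "d \<in> lower_central G (Suc i)" using eq c by (simp add: d_def gr_class_eq_iff)
  then have d': "d \<in> lower_central G i" using lower_central_Suc_subset by blast
  have x: "x = d \<otimes> y" using c by (simp add: d_def m_assoc)
  have "commutator G d z \<in> lower_central G (Suc (i + j))"
    using commutator_lower_central_add[OF _ assms(2) d assms(5)] by simp
  then have "gr_class G (i + j) (commutator G d z) = \<one>\<^bsub>gr G (i + j)\<^esub>"
    using c d by (simp add: gr_class_eq_one_iff lower_central_carrier)
  then show ?thesis
    using assms d' unfolding x
    by (simp add: gr_class_commutator_mult_left gr_classI commutator_lower_central_add)
qed

lemma gr_class_commutator_cong:
  assumes "i \<ge> 1" "j \<ge> 1"
    and "x \<in> lower_central G i" "x' \<in> lower_central G i"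
    and "y \<in> lower_central G j" "y' \<in> lower_central G j"
    and "gr_class G i x = gr_class G i x'" "gr_class G j y = gr_class G j y'"
  shows "gr_class G (i + j) (commutator G x y) = gr_class G (i + j) (commutator G x' y')"
proof -
  have "gr_class G (i + j) (commutator G x y) = gr_class G (i + j) (commutator G x' y)"
    using assms by (intro gr_class_commutator_cong_left)
  also have "\<dots> = gr_class G (i + j) (commutator G x' y')"
  proof -
    \<comment> \<open>For the second argument: exchange the entries, change what is now the left
      entry, and exchange back.\<close>
    have "gr_class G (i + j) (commutator G y x') = gr_class G (i + j) (commutator G y' x')"
      using gr_class_commutator_cong_left[of j i y y' x'] assms by (simp add: add.commute)
    then show ?thesis
      using gr_class_commutator_swap[of j i y x'] gr_class_commutator_swap[of j i y' x'] assms
      by (simp add: add.commute)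
  qed
  finally show ?thesis .
qed

text \<open>All cosets in the union coincide by \<open>gr_class_commutator_cong\<close>, and the
  union is not empty because each class contains its representative.\<close>

lemma gr_bracket_class:
  assumes "i \<ge> 1" "j \<ge> 1" "a \<in> lower_central G i" "b \<in> lower_central G j"
  shows "gr_bracket G i j (gr_class G i a) (gr_class G j b) = gr_class G (i + j) (commutator G a b)"
proof -
  have "lower_central G (Suc (i + j)) #> commutator G x y = gr_class G (i + j) (commutator G a b)"
    if "x \<in> gr_class G i a" "y \<in> gr_class G j b" for x y
    unfolding gr_class_def[symmetric]
    using gr_class_memD[OF that(1) assms(3)] gr_class_memD[OF that(2) assms(4)] assms
    by (intro gr_class_commutator_cong) auto
  moreover have "gr_class G i a \<noteq> {}" "gr_class G j b \<noteq> {}"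
    using gr_class_self assms by blast+
  ultimately show ?thesis unfolding gr_bracket_def by auto
qed

lemma gr_bracket_closed:
  assumes "i \<ge> 1" "j \<ge> 1" "X \<in> carrier (gr G i)" "Y \<in> carrier (gr G j)"
  shows "gr_bracket G i j X Y \<in> carrier (gr G (i + j))"
  using assms by (auto simp: carrier_gr gr_bracket_class commutator_lower_central_add)

lemma gr_bracket_swap:
  assumes "i \<ge> 1" "j \<ge> 1" "X \<in> carrier (gr G i)" "Y \<in> carrier (gr G j)"
  shows "gr_bracket G j i Y X = inv\<^bsub>gr G (i + j)\<^esub> gr_bracket G i j X Y"
proof -
  obtain a b where "a \<in> lower_central G i" "b \<in> lower_central G j"
    "X = gr_class G i a" "Y = gr_class G j b"
    using assms by (auto simp: carrier_gr)
  then show ?thesis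
    using assms gr_class_commutator_swap[of i j a b]
    by (simp add: gr_bracket_class add.commute)
qed

lemma gr_bracket_mult_left:
  assumes "i \<ge> 1" "j \<ge> 1"
    and "X \<in> carrier (gr G i)" "X' \<in> carrier (gr G i)" "Y \<in> carrier (gr G j)"
  shows "gr_bracket G i j (X \<otimes>\<^bsub>gr G i\<^esub> X') Y
    = gr_bracket G i j X Y \<otimes>\<^bsub>gr G (i + j)\<^esub> gr_bracket G i j X' Y"
proof -
  obtain a a' b where ab: "a \<in> lower_central G i" "a' \<in> lower_central G i" "b \<in> lower_central G j"
    "X = gr_class G i a" "X' = gr_class G i a'" "Y = gr_class G j b"
    using assms by (auto simp: carrier_gr)
  have "X \<otimes>\<^bsub>gr G i\<^esub> X' = gr_class G i (a \<otimes> a')"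
    using ab by (simp add: gr_class_mult lower_central_carrier)
  then show ?thesis
    using assms(1,2) ab by (simp add: gr_bracket_class gr_class_commutator_mult_left lower_central_mult)
qed

text \<open>Antisymmetry reduces this to the left argument; inversion respects products because the
  graded piece is commutative.\<close>

lemma gr_bracket_mult_right:
  assumes "i \<ge> 1" "j \<ge> 1"
    and "X \<in> carrier (gr G i)" "Y \<in> carrier (gr G j)" "Y' \<in> carrier (gr G j)"
  shows "gr_bracket G i j X (Y \<otimes>\<^bsub>gr G j\<^esub> Y')
    = gr_bracket G i j X Y \<otimes>\<^bsub>gr G (i + j)\<^esub> gr_bracket G i j X Y'"
proof -
  interpret gr: comm_group "gr G (i + j)" using comm_group_gr assms(1) by simp
  interpret grj: group "gr G j" by (rule group_gr)
  have closed: "gr_bracket G j i Y X \<in> carrier (gr G (i + j))"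
    "gr_bracket G j i Y' X \<in> carrier (gr G (i + j))"
    using assms gr_bracket_closed[of j i _ X] by (auto simp: add.commute)
  have "gr_bracket G j i (Y \<otimes>\<^bsub>gr G j\<^esub> Y') X
      = gr_bracket G j i Y X \<otimes>\<^bsub>gr G (i + j)\<^esub> gr_bracket G j i Y' X"
    using gr_bracket_mult_left[of j i Y Y' X] assms by (simp add: add.commute)
  then show ?thesis
    using assms closed gr_bracket_swap[of j i _ X]
    by (simp add: add.commute gr.inv_mult)
qed

lemma gr_bracket_one:
  assumes "i \<ge> 1" "j \<ge> 1"
  shows "X \<in> carrier (gr G i) \<Longrightarrow> gr_bracket G i j X \<one>\<^bsub>gr G j\<^esub> = \<one>\<^bsub>gr G (i + j)\<^esub>"
    and "Y \<in> carrier (gr G j) \<Longrightarrow> gr_bracket G i j \<one>\<^bsub>gr G i\<^esub> Y = \<one>\<^bsub>gr G (i + j)\<^esub>"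
proof -
  have "gr_bracket G i j (gr_class G i a) (gr_class G j \<one>) = \<one>\<^bsub>gr G (i + j)\<^esub>"
    if "a \<in> lower_central G i" for a
    using that assms gr_class_one[of "i + j"] by (simp add: gr_bracket_class lower_central_carrier)
  then show "X \<in> carrier (gr G i) \<Longrightarrow> gr_bracket G i j X \<one>\<^bsub>gr G j\<^esub> = \<one>\<^bsub>gr G (i + j)\<^esub>"
    by (auto simp: carrier_gr gr_class_one)
  have "gr_bracket G i j (gr_class G i \<one>) (gr_class G j b) = \<one>\<^bsub>gr G (i + j)\<^esub>"
    if "b \<in> lower_central G j" for b
  proof -
    have "commutator G \<one> b = \<one>" using lower_central_carrier[OF that] by (simp add: commutator_def)
    then show ?thesis using that assms gr_class_one[of "i + j"] by (simp add: gr_bracket_class)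
  qed
  then show "Y \<in> carrier (gr G j) \<Longrightarrow> gr_bracket G i j \<one>\<^bsub>gr G i\<^esub> Y = \<one>\<^bsub>gr G (i + j)\<^esub>"
    by (auto simp: carrier_gr gr_class_one)
qed

end


section \<open>The Lie ring of a group\<close>

lemma one_group_lie_ring: "\<one>\<^bsub>group_lie_ring G\<^esub> = (\<lambda>i \<in> {1..}. \<one>\<^bsub>gr G i\<^esub>)"
  by (simp add: group_lie_ring_def)

lemma mult_group_lie_ring:
  "x \<otimes>\<^bsub>group_lie_ring G\<^esub> y = (\<lambda>i \<in> {1..}. x i \<otimes>\<^bsub>gr G i\<^esub> y i)"
  by (simp add: group_lie_ring_def)

lemma bracket_group_lie_ring:
  "bracket (group_lie_ring G) x y = (\<lambda>n \<in> {1..}.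
     finprod (gr G n) (\<lambda>i. gr_bracket G i (n - i) (x i) (y (n - i))) {1..<n})"
  by (simp add: group_lie_ring_def)

context group
begin

lemma carrier_group_lie_ring:
  "carrier (group_lie_ring G) = {x \<in> extensional {1..}.
     (\<forall>i \<ge> 1. x i \<in> carrier (gr G i)) \<and> finite {i \<in> {1..}. x i \<noteq> \<one>\<^bsub>gr G i\<^esub>}}"
  by (auto simp: group_lie_ring_def carrier_sum_group group_gr PiE_def)

lemma group_lie_ring_component:
  "\<lbrakk>x \<in> carrier (group_lie_ring G); i \<ge> 1\<rbrakk> \<Longrightarrow> x i \<in> carrier (gr G i)"
  by (simp add: carrier_group_lie_ring)

lemma group_lie_ring_eqI:
  "\<lbrakk>x \<in> carrier (group_lie_ring G); y \<in> carrier (group_lie_ring G); \<And>i. i \<ge> 1 \<Longrightarrow> x i = y i\<rbrakk>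
   \<Longrightarrow> x = y"
  by (rule extensionalityI[of _ "{1..}"]) (auto simp: carrier_group_lie_ring)

lemma group_lie_ring_class:
  assumes "x \<in> carrier (group_lie_ring G)" "i \<ge> 1"
  obtains g where "g \<in> lower_central G i" "x i = gr_class G i g"
  using group_lie_ring_component[OF assms] by (auto simp: carrier_gr)

lemma group_lie_ring_bounded:
  assumes "x \<in> carrier (group_lie_ring G)"
  obtains m where "\<And>i. i > m \<Longrightarrow> x i = \<one>\<^bsub>gr G i\<^esub>"
proof -
  have "finite {i \<in> {1..}. x i \<noteq> \<one>\<^bsub>gr G i\<^esub>}"
    using assms by (simp add: carrier_group_lie_ring)
  then obtain m where m: "\<And>i. i \<in> {i \<in> {1..}. x i \<noteq> \<one>\<^bsub>gr G i\<^esub>} \<Longrightarrow> i \<le> m"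
    unfolding finite_nat_set_iff_bounded_le by blast
  have "x i = \<one>\<^bsub>gr G i\<^esub>" if "i > m" for i
    using m[of i] that by (cases "x i = \<one>\<^bsub>gr G i\<^esub>") auto
  then show ?thesis using that by blast
qed

text \<open>The record carries an additional bracket field, so it is not literally the direct sum;
  the axioms involve only the shared fields and are transported by rewriting these.\<close>

lemma comm_group_group_lie_ring: "comm_group (group_lie_ring G)"
proof -
  interpret S: group "sum_group {1..} (gr G)" by (rule sum_group) (rule group_gr)
  have fields: "carrier (group_lie_ring G) = carrier (sum_group {1..} (gr G))"
    "mult (group_lie_ring G) = mult (sum_group {1..} (gr G))"
    "one (group_lie_ring G) = one (sum_group {1..} (gr G))"
    by (simp_all add: group_lie_ring_def)
  show ?thesis
  proof (rule comm_groupI, unfold fields)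
    fix x y assume xy: "x \<in> carrier (sum_group {1..} (gr G))" "y \<in> carrier (sum_group {1..} (gr G))"
    have "x i \<otimes>\<^bsub>gr G i\<^esub> y i = y i \<otimes>\<^bsub>gr G i\<^esub> x i" if "i \<ge> 1" for i
    proof -
      interpret gr: comm_group "gr G i" by (rule comm_group_gr[OF that])
      have "x i \<in> carrier (gr G i)" "y i \<in> carrier (gr G i)"
        using group_lie_ring_component[OF _ that] xy unfolding fields by blast+
      then show ?thesis by (rule gr.m_comm)
    qed
    then show "x \<otimes>\<^bsub>sum_group {1..} (gr G)\<^esub> y = y \<otimes>\<^bsub>sum_group {1..} (gr G)\<^esub> x"
      by (auto intro: restrict_ext)
  qed (fact S.m_closed S.one_closed S.m_assoc S.l_one S.l_inv_ex)+
qed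

section \<open>Closure and biadditivity of the bracket\<close>

lemma gr_bracket_component_closed:
  assumes "x \<in> carrier (group_lie_ring G)" "y \<in> carrier (group_lie_ring G)"
  shows "(\<lambda>i. gr_bracket G i (n - i) (x i) (y (n - i))) \<in> {1..<n} \<rightarrow> carrier (gr G n)"
proof
  fix i assume "i \<in> {1..<n}"
  then show "gr_bracket G i (n - i) (x i) (y (n - i)) \<in> carrier (gr G n)"
    using gr_bracket_closed[of i "n - i" "x i" "y (n - i)"] assms
    by (auto simp: group_lie_ring_component)
qed

text \<open>Finite support: if x vanishes above degree m and y above degree k, then in degree n > m
  + k one entry of each pair of components of degrees i and n - i vanishes.\<close>

lemma bracket_closed:
  assumes x: "x \<in> carrier (group_lie_ring G)" and y: "y \<in> carrier (group_lie_ring G)"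
  shows "bracket (group_lie_ring G) x y \<in> carrier (group_lie_ring G)"
proof -
  obtain m where m: "\<And>i. i > m \<Longrightarrow> x i = \<one>\<^bsub>gr G i\<^esub>" using group_lie_ring_bounded[OF x] by blast
  obtain k where k: "\<And>i. i > k \<Longrightarrow> y i = \<one>\<^bsub>gr G i\<^esub>" using group_lie_ring_bounded[OF y] by blast
  have "bracket (group_lie_ring G) x y n = \<one>\<^bsub>gr G n\<^esub>" if n: "n > m + k" for n
  proof -
    interpret gr: comm_group "gr G n" using n by (intro comm_group_gr) simp
    have "gr_bracket G i (n - i) (x i) (y (n - i)) = \<one>\<^bsub>gr G n\<^esub>" if i: "i \<in> {1..<n}" for i
    proof (cases "i > m")
      case True
      then show ?thesis
        using gr_bracket_one(2)[of i "n - i" "y (n - i)"] i m y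
        by (simp add: group_lie_ring_component)
    next
      case False
      then have "n - i > k" using n by simp
      then show ?thesis
        using gr_bracket_one(1)[of i "n - i" "x i"] i k x
        by (simp add: group_lie_ring_component)
    qed
    then have "finprod (gr G n) (\<lambda>i. gr_bracket G i (n - i) (x i) (y (n - i))) {1..<n} = \<one>\<^bsub>gr G n\<^esub>"
      by (rule gr.finprod_one_eqI)
    then show ?thesis using n by (simp add: bracket_group_lie_ring)
  qed
  then have "{n \<in> {1..}. bracket (group_lie_ring G) x y n \<noteq> \<one>\<^bsub>gr G n\<^esub>} \<subseteq> {..m + k}"
    by (metis (mono_tags, lifting) atMost_iff linorder_not_le mem_Collect_eq subsetI)
  then have "finite {n \<in> {1..}. bracket (group_lie_ring G) x y n \<noteq> \<one>\<^bsub>gr G n\<^esub>}"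
    by (rule finite_subset) simp
  moreover have "bracket (group_lie_ring G) x y n \<in> carrier (gr G n)" if "n \<ge> 1" for n
  proof -
    interpret gr: comm_group "gr G n" by (rule comm_group_gr[OF that])
    show ?thesis
      using gr.finprod_closed[OF gr_bracket_component_closed[OF x y]] that
      by (simp add: bracket_group_lie_ring)
  qed
  ultimately show ?thesis by (simp add: carrier_group_lie_ring) (simp add: bracket_group_lie_ring)
qed

lemma bracket_mult_left:
  assumes "x \<in> carrier (group_lie_ring G)" "x' \<in> carrier (group_lie_ring G)"
    "y \<in> carrier (group_lie_ring G)"
  shows "bracket (group_lie_ring G) (x \<otimes>\<^bsub>group_lie_ring G\<^esub> x') y
    = bracket (group_lie_ring G) x y \<otimes>\<^bsub>group_lie_ring G\<^esub> bracket (group_lie_ring G) x' y"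
proof -
  have "finprod (gr G n) (\<lambda>i. gr_bracket G i (n - i) ((x \<otimes>\<^bsub>group_lie_ring G\<^esub> x') i) (y (n - i))) {1..<n}
      = finprod (gr G n) (\<lambda>i. gr_bracket G i (n - i) (x i) (y (n - i))) {1..<n} \<otimes>\<^bsub>gr G n\<^esub>
        finprod (gr G n) (\<lambda>i. gr_bracket G i (n - i) (x' i) (y (n - i))) {1..<n}"
    if n: "n \<ge> 1" for n
  proof -
    interpret gr: comm_group "gr G n" by (rule comm_group_gr[OF n])
    note c = gr_bracket_component_closed[OF assms(1,3), of n]
      gr_bracket_component_closed[OF assms(2,3), of n]
    have "gr_bracket G i (n - i) ((x \<otimes>\<^bsub>group_lie_ring G\<^esub> x') i) (y (n - i))
        = gr_bracket G i (n - i) (x i) (y (n - i)) \<otimes>\<^bsub>gr G n\<^esub>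
          gr_bracket G i (n - i) (x' i) (y (n - i))" if "i \<in> {1..<n}" for i
    proof -
      have "n - i \<ge> 1" using that by auto
      then show ?thesis
        using gr_bracket_mult_left[of i "n - i" "x i" "x' i" "y (n - i)"] that assms
        by (simp add: mult_group_lie_ring group_lie_ring_component)
    qed
    then show ?thesis
      unfolding gr.finprod_multf[OF c, symmetric] using c
      by (intro gr.finprod_cong') (auto simp: Pi_iff)
  qed
  then show ?thesis
    \<comment> \<open>The instantiation unfolds only the outer sum and keeps the sum inside the
      bracket in the form used above.\<close>
    unfolding mult_group_lie_ring[of G "bracket (group_lie_ring G) x y"]
    unfolding bracket_group_lie_ring
    by (auto intro!: restrict_ext)
qed

lemma bracket_mult_right:
  assumes "x \<in> carrier (group_lie_ring G)" "y \<in> carrier (group_lie_ring G)"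
    "y' \<in> carrier (group_lie_ring G)"
  shows "bracket (group_lie_ring G) x (y \<otimes>\<^bsub>group_lie_ring G\<^esub> y')
    = bracket (group_lie_ring G) x y \<otimes>\<^bsub>group_lie_ring G\<^esub> bracket (group_lie_ring G) x y'"
proof -
  have "finprod (gr G n) (\<lambda>i. gr_bracket G i (n - i) (x i) ((y \<otimes>\<^bsub>group_lie_ring G\<^esub> y') (n - i))) {1..<n}
      = finprod (gr G n) (\<lambda>i. gr_bracket G i (n - i) (x i) (y (n - i))) {1..<n} \<otimes>\<^bsub>gr G n\<^esub>
        finprod (gr G n) (\<lambda>i. gr_bracket G i (n - i) (x i) (y' (n - i))) {1..<n}"
    if n: "n \<ge> 1" for n
  proof -
    interpret gr: comm_group "gr G n" by (rule comm_group_gr[OF n])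
    note c = gr_bracket_component_closed[OF assms(1,2), of n]
      gr_bracket_component_closed[OF assms(1,3), of n]
    have "gr_bracket G i (n - i) (x i) ((y \<otimes>\<^bsub>group_lie_ring G\<^esub> y') (n - i))
        = gr_bracket G i (n - i) (x i) (y (n - i)) \<otimes>\<^bsub>gr G n\<^esub>
          gr_bracket G i (n - i) (x i) (y' (n - i))" if "i \<in> {1..<n}" for i
    proof -
      have "n - i \<ge> 1" using that by auto
      then show ?thesis
        using gr_bracket_mult_right[of i "n - i" "x i" "y (n - i)" "y' (n - i)"] that assms
        by (simp add: mult_group_lie_ring group_lie_ring_component)
    qed
    then show ?thesis
      unfolding gr.finprod_multf[OF c, symmetric] using c
      by (intro gr.finprod_cong') (auto simp: Pi_iff)
  qed
  then show ?thesis
    unfolding mult_group_lie_ring[of G "bracket (group_lie_ring G) x y"]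
    unfolding bracket_group_lie_ring
    by (auto intro!: restrict_ext)
qed

section \<open>Homogeneous elements and the center of the Lie ring\<close>

lemma lie_class_component:
  "j \<ge> 1 \<Longrightarrow> lie_class G i g j = (if j = i then gr_class G i g else \<one>\<^bsub>gr G j\<^esub>)"
  by (simp add: lie_class_def gr_class_def)

lemma lie_class_closed:
  assumes "g \<in> lower_central G i"
  shows "lie_class G i g \<in> carrier (group_lie_ring G)"
proof -
  have "finite {j \<in> {1..}. lie_class G i g j \<noteq> \<one>\<^bsub>gr G j\<^esub>}"
    by (rule finite_subset[of _ "{i}"]) (auto simp: lie_class_component split: if_splits)
  moreover have "lie_class G i g j \<in> carrier (gr G j)" if "j \<ge> 1" for j
    using that assms monoid.one_closed[OF group.is_monoid[OF group_gr]]
    by (auto simp: lie_class_component gr_classI)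
  ultimately show ?thesis by (simp add: carrier_group_lie_ring) (simp add: lie_class_def)
qed

text \<open>Testing against homogeneous elements isolates single components, so centrality becomes a
  condition on each component separately: the center is graded.\<close>

lemma lie_center_iff:
  "z \<in> lie_center (group_lie_ring G) \<longleftrightarrow> z \<in> carrier (group_lie_ring G) \<and>
    (\<forall>i \<ge> 1. \<forall>k \<ge> 1. \<forall>Y \<in> carrier (gr G k). gr_bracket G i k (z i) Y = \<one>\<^bsub>gr G (i + k)\<^esub>)"
proof (intro iffI conjI allI impI ballI)
  assume z: "z \<in> lie_center (group_lie_ring G)"
  then show zc: "z \<in> carrier (group_lie_ring G)" by (simp add: lie_center_def)
  fix i k :: nat and Y
  assume i: "i \<ge> 1" and k: "k \<ge> 1" and "Y \<in> carrier (gr G k)"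
  then obtain h where h: "h \<in> lower_central G k" "Y = gr_class G k h" by (auto simp: carrier_gr)
  interpret gr: comm_group "gr G (i + k)" using i by (intro comm_group_gr) simp
  let ?x = "lie_class G k h" and ?n = "i + k"
  note x = lie_class_closed[OF h(1)]
  \<comment> \<open>The test element \<open>?x\<close> is zero outside degree k, so in degree i + k
    only the summand j = i survives. The conditional form is the one that
    \<open>finprod_singleton_swap\<close> evaluates.\<close>
  have "gr_bracket G j (?n - j) (z j) (?x (?n - j))
      = (if j = i then gr_bracket G j (?n - j) (z j) (?x (?n - j)) else \<one>\<^bsub>gr G ?n\<^esub>)"
    if j: "j \<in> {1..<?n}" for j
  proof (cases "j = i")
    case False
    have "?n - j \<ge> 1" "?n - j \<noteq> k" using j False by auto
    then show ?thesis
      using gr_bracket_one(1)[of j "?n - j" "z j"] j zc False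
      by (simp add: lie_class_component group_lie_ring_component)
  qed simp
  then have "finprod (gr G ?n) (\<lambda>j. gr_bracket G j (?n - j) (z j) (?x (?n - j))) {1..<?n}
      = finprod (gr G ?n) (\<lambda>j. if j = i then gr_bracket G j (?n - j) (z j) (?x (?n - j))
          else \<one>\<^bsub>gr G ?n\<^esub>) {1..<?n}"
    using gr_bracket_component_closed[OF zc x, of ?n]
    by (intro gr.finprod_cong') (auto simp: Pi_iff)
  also have "\<dots> = gr_bracket G i (?n - i) (z i) (?x (?n - i))"
    using gr_bracket_component_closed[OF zc x, of ?n] i k
    by (subst gr.finprod_singleton_swap) auto
  also have "\<dots> = gr_bracket G i k (z i) Y" using k by (simp add: lie_class_component h(2))
  finally have "bracket (group_lie_ring G) z ?x ?n = gr_bracket G i k (z i) Y"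
    using i by (simp add: bracket_group_lie_ring)
  moreover have "bracket (group_lie_ring G) z ?x = \<one>\<^bsub>group_lie_ring G\<^esub>"
    using z x by (simp add: lie_center_def)
  ultimately show "gr_bracket G i k (z i) Y = \<one>\<^bsub>gr G ?n\<^esub>"
    using i by (simp add: one_group_lie_ring)
next
  assume z: "z \<in> carrier (group_lie_ring G) \<and>
    (\<forall>i \<ge> 1. \<forall>k \<ge> 1. \<forall>Y \<in> carrier (gr G k). gr_bracket G i k (z i) Y = \<one>\<^bsub>gr G (i + k)\<^esub>)"
  have "bracket (group_lie_ring G) z x = \<one>\<^bsub>group_lie_ring G\<^esub>"
    if x: "x \<in> carrier (group_lie_ring G)" for x
  proof -
    have "finprod (gr G n) (\<lambda>i. gr_bracket G i (n - i) (z i) (x (n - i))) {1..<n} = \<one>\<^bsub>gr G n\<^esub>"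
      if "n \<ge> 1" for n
    proof -
      interpret gr: comm_group "gr G n" by (rule comm_group_gr[OF that])
      have "gr_bracket G i (n - i) (z i) (x (n - i)) = \<one>\<^bsub>gr G n\<^esub>" if i: "i \<in> {1..<n}" for i
      proof -
        have "n - i \<ge> 1" using i by auto
        then show ?thesis
          using z[THEN conjunct2, rule_format, of i "n - i" "x (n - i)"] i x
          by (simp add: group_lie_ring_component)
      qed
      then show ?thesis by (rule gr.finprod_one_eqI)
    qed
    then show ?thesis
      unfolding bracket_group_lie_ring one_group_lie_ring by (auto intro: restrict_ext)
  qed
  then show "z \<in> lie_center (group_lie_ring G)" using z by (simp add: lie_center_def)
qed

text \<open>A bracket vanishes in degree i + k when the commutator lies in term i + k + 1. So
  centrality asks g to raise degrees by i + 1, one more than membership in term i provides.\<close>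

lemma lie_center_class_iff:
  "z \<in> lie_center (group_lie_ring G) \<longleftrightarrow> z \<in> carrier (group_lie_ring G) \<and>
    (\<forall>i \<ge> 1. \<exists>g \<in> lower_central G i \<inter> degree_raising G (Suc i). z i = gr_class G i g)"
proof -
  have "(\<forall>k \<ge> 1. \<forall>Y \<in> carrier (gr G k). gr_bracket G i k (gr_class G i g) Y = \<one>\<^bsub>gr G (i + k)\<^esub>)
      \<longleftrightarrow> g \<in> degree_raising G (Suc i)" if "i \<ge> 1" "g \<in> lower_central G i" for i g
    using that
    by (simp add: carrier_gr gr_bracket_class gr_class_eq_one_iff lower_central_carrier
        degree_raising_def add.commute[of i])
  then show ?thesis
    unfolding lie_center_iff using group_lie_ring_class by (metis IntE IntI)
qed

text \<open>\<open>lie_center\<close> is defined with z on the left; antisymmetry in each degree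
  gives this version, which is used to show that the bracket on the quotient is well
  defined.\<close>

lemma lie_center_bracket_right:
  assumes z: "z \<in> lie_center (group_lie_ring G)" and x: "x \<in> carrier (group_lie_ring G)"
  shows "bracket (group_lie_ring G) x z = \<one>\<^bsub>group_lie_ring G\<^esub>"
proof -
  note zc = z[unfolded lie_center_iff, THEN conjunct1]
  have "finprod (gr G n) (\<lambda>i. gr_bracket G i (n - i) (x i) (z (n - i))) {1..<n} = \<one>\<^bsub>gr G n\<^esub>"
    if "n \<ge> 1" for n
  proof -
    interpret gr: comm_group "gr G n" by (rule comm_group_gr[OF that])
    have "gr_bracket G i (n - i) (x i) (z (n - i)) = \<one>\<^bsub>gr G n\<^esub>" if i: "i \<in> {1..<n}" for i
    proof -
      have "n - i \<ge> 1" using i by auto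
      then show ?thesis
        using z[unfolded lie_center_iff, THEN conjunct2, rule_format, of "n - i" i "x i"] i x zc
          gr_bracket_swap[of "n - i" i "z (n - i)" "x i"]
        by (simp add: group_lie_ring_component)
    qed
    then show ?thesis by (rule gr.finprod_one_eqI)
  qed
  then show ?thesis
    unfolding bracket_group_lie_ring one_group_lie_ring by (auto intro: restrict_ext)
qed

text \<open>The center is the intersection of the kernels of the additive maps
  \<open>\<lambda>z. ?B z x\<close>.\<close>

lemma lie_center_subgroup: "subgroup (lie_center (group_lie_ring G)) (group_lie_ring G)"
proof -
  interpret L: comm_group "group_lie_ring G" by (rule comm_group_group_lie_ring)
  let ?B = "bracket (group_lie_ring G)"
  have ad: "group_hom (group_lie_ring G) (group_lie_ring G) (\<lambda>z. ?B z x)"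
    if "x \<in> carrier (group_lie_ring G)" for x
    using that by unfold_locales (auto simp: hom_def bracket_closed bracket_mult_left)
  show ?thesis
  proof (rule L.subgroupI)
    show "lie_center (group_lie_ring G) \<subseteq> carrier (group_lie_ring G)" by (auto simp: lie_center_def)
    have "\<one>\<^bsub>group_lie_ring G\<^esub> \<in> lie_center (group_lie_ring G)"
      using group_hom.hom_one[OF ad] by (simp add: lie_center_def)
    then show "lie_center (group_lie_ring G) \<noteq> {}" by blast
  next
    fix z assume "z \<in> lie_center (group_lie_ring G)"
    then show "inv\<^bsub>group_lie_ring G\<^esub> z \<in> lie_center (group_lie_ring G)"
      using group_hom.hom_inv[OF ad] by (simp add: lie_center_def)
  next
    fix z w assume "z \<in> lie_center (group_lie_ring G)" "w \<in> lie_center (group_lie_ring G)"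
    then show "z \<otimes>\<^bsub>group_lie_ring G\<^esub> w \<in> lie_center (group_lie_ring G)"
      by (simp add: lie_center_def bracket_mult_left)
  qed
qed

end


section \<open>Functoriality of the Lie ring\<close>

definition gr_map :: "('b, 'n) monoid_scheme \<Rightarrow> ('a \<Rightarrow> 'b) \<Rightarrow> nat \<Rightarrow> 'a set \<Rightarrow> 'b set" where
  "gr_map H f i X = (\<Union>a \<in> X. gr_class H i (f a))"

lemma lie_map_eq: "lie_map H f x = (\<lambda>i \<in> {1..}. gr_map H f i (x i))"
  by (simp add: lie_map_def gr_map_def gr_class_def)

context group_hom
begin

lemma hom_lower_central: "g \<in> lower_central G i \<Longrightarrow> h g \<in> lower_central H i"
  using lower_central_img_subset by blast

text \<open>Two representatives differ by an element of term i + 1, whose image lies in term i + 1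
  of \<open>H\<close>; hence the union is over equal cosets.\<close>

lemma gr_map_class:
  assumes a: "a \<in> lower_central G i"
  shows "gr_map H h i (gr_class G i a) = gr_class H i (h a)"
proof -
  have "gr_class H i (h b) = gr_class H i (h a)" if b: "b \<in> gr_class G i a" for b
  proof -
    note b' = G.gr_class_memD[OF b a]
    have c: "a \<in> carrier G" "b \<in> carrier G" using a b' by (auto simp: G.lower_central_carrier)
    have "h (b \<otimes> inv a) \<in> lower_central H (Suc i)"
      using b'(2) c by (intro hom_lower_central) (simp add: G.gr_class_eq_iff)
    then show ?thesis using c by (simp add: H.gr_class_eq_iff)
  qed
  then show ?thesis using G.gr_class_self[OF a] unfolding gr_map_def by blast
qed

lemma gr_map_group_hom: "group_hom (gr G i) (gr H i) (gr_map H h i)"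
proof (intro group_hom.intro group_hom_axioms.intro homI G.group_gr H.group_gr)
  fix X assume "X \<in> carrier (gr G i)"
  then show "gr_map H h i X \<in> carrier (gr H i)"
    by (auto simp: carrier_gr gr_map_class hom_lower_central)
next
  fix X Y assume "X \<in> carrier (gr G i)" "Y \<in> carrier (gr G i)"
  then obtain a b where ab: "a \<in> lower_central G i" "b \<in> lower_central G i"
    "X = gr_class G i a" "Y = gr_class G i b"
    by (auto simp: carrier_gr)
  then have "X \<otimes>\<^bsub>gr G i\<^esub> Y = gr_class G i (a \<otimes> b)"
    by (simp add: G.gr_class_mult G.lower_central_carrier)
  then show "gr_map H h i (X \<otimes>\<^bsub>gr G i\<^esub> Y) = gr_map H h i X \<otimes>\<^bsub>gr H i\<^esub> gr_map H h i Y"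
    using ab by (simp add: gr_map_class G.lower_central_mult H.gr_class_mult G.lower_central_carrier)
qed

lemma gr_map_bracket:
  assumes "i \<ge> 1" "j \<ge> 1" "X \<in> carrier (gr G i)" "Y \<in> carrier (gr G j)"
  shows "gr_map H h (i + j) (gr_bracket G i j X Y)
    = gr_bracket H i j (gr_map H h i X) (gr_map H h j Y)"
proof -
  obtain a b where "a \<in> lower_central G i" "b \<in> lower_central G j"
    "X = gr_class G i a" "Y = gr_class G j b"
    using assms by (auto simp: carrier_gr)
  then show ?thesis
    using assms(1,2)
    by (simp add: G.gr_bracket_class H.gr_bracket_class gr_map_class hom_lower_central
        G.commutator_lower_central_add hom_commutator G.lower_central_carrier)
qed

lemma lie_map_closed:
  assumes x: "x \<in> carrier (group_lie_ring G)"
  shows "lie_map H h x \<in> carrier (group_lie_ring H)"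
proof -
  \<comment> \<open>Zero components are sent to zero, so the support does not grow.\<close>
  have "{i \<in> {1..}. lie_map H h x i \<noteq> \<one>\<^bsub>gr H i\<^esub>} \<subseteq> {i \<in> {1..}. x i \<noteq> \<one>\<^bsub>gr G i\<^esub>}"
    using group_hom.hom_one[OF gr_map_group_hom] by (auto simp: lie_map_eq)
  moreover have "finite {i \<in> {1..}. x i \<noteq> \<one>\<^bsub>gr G i\<^esub>}"
    using x by (simp add: G.carrier_group_lie_ring)
  ultimately have "finite {i \<in> {1..}. lie_map H h x i \<noteq> \<one>\<^bsub>gr H i\<^esub>}" by (rule finite_subset)
  moreover have "lie_map H h x i \<in> carrier (gr H i)" if "i \<ge> 1" for i
    using group_hom.hom_closed[OF gr_map_group_hom G.group_lie_ring_component[OF x that]] that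
    by (simp add: lie_map_eq)
  ultimately show ?thesis
    by (simp add: H.carrier_group_lie_ring) (simp add: lie_map_eq)
qed

lemma lie_map_group_hom: "group_hom (group_lie_ring G) (group_lie_ring H) (lie_map H h)"
proof (intro group_hom.intro group_hom_axioms.intro homI)
  show "group (group_lie_ring G)" "group (group_lie_ring H)"
    using G.comm_group_group_lie_ring H.comm_group_group_lie_ring by (auto dest: comm_group.axioms)
next
  fix x y assume x: "x \<in> carrier (group_lie_ring G)" and y: "y \<in> carrier (group_lie_ring G)"
  then show "lie_map H h (x \<otimes>\<^bsub>group_lie_ring G\<^esub> y)
      = lie_map H h x \<otimes>\<^bsub>group_lie_ring H\<^esub> lie_map H h y"
    unfolding lie_map_eq mult_group_lie_ring
    by (intro restrict_ext)
      (simp add: group_hom.hom_mult[OF gr_map_group_hom] G.group_lie_ring_component)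
qed (rule lie_map_closed)

lemma lie_map_bracket:
  assumes x: "x \<in> carrier (group_lie_ring G)" and y: "y \<in> carrier (group_lie_ring G)"
  shows "lie_map H h (bracket (group_lie_ring G) x y)
    = bracket (group_lie_ring H) (lie_map H h x) (lie_map H h y)"
proof -
  have "gr_map H h n (finprod (gr G n) (\<lambda>i. gr_bracket G i (n - i) (x i) (y (n - i))) {1..<n})
      = finprod (gr H n) (\<lambda>i. gr_bracket H i (n - i) (lie_map H h x i) (lie_map H h y (n - i))) {1..<n}"
    if n: "n \<ge> 1" for n
  proof -
    interpret grG: comm_group "gr G n" by (rule G.comm_group_gr[OF n])
    interpret grH: comm_group "gr H n" by (rule H.comm_group_gr[OF n])
    have "gr_map H h n (gr_bracket G i (n - i) (x i) (y (n - i)))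
        = gr_bracket H i (n - i) (lie_map H h x i) (lie_map H h y (n - i))"
      if i: "i \<in> {1..<n}" for i
    proof -
      have "n - i \<ge> 1" using i by auto
      then show ?thesis
        using gr_map_bracket[of i "n - i" "x i" "y (n - i)"] i x y
        by (simp add: G.group_lie_ring_component lie_map_eq)
    qed
    then show ?thesis
      unfolding grG.finprod_hom[OF gr_map_group_hom grH.comm_group_axioms
          G.gr_bracket_component_closed[OF x y]]
      using H.gr_bracket_component_closed[OF lie_map_closed[OF x] lie_map_closed[OF y], of n]
      by (intro grH.finprod_cong') auto
  qed
  then show ?thesis
    \<comment> \<open>Only the outer \<open>lie_map\<close> is unfolded; those inside the bracket
      stay in the form of the identity above.\<close>
    unfolding lie_map_eq[of H h "bracket (group_lie_ring G) x y"]
    unfolding bracket_group_lie_ring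
    by (auto intro!: restrict_ext)
qed

lemma lie_map_surj:
  assumes surj: "h ` carrier G = carrier H"
  shows "lie_map H h ` carrier (group_lie_ring G) = carrier (group_lie_ring H)"
proof
  show "lie_map H h ` carrier (group_lie_ring G) \<subseteq> carrier (group_lie_ring H)"
    using lie_map_closed by blast
  show "carrier (group_lie_ring H) \<subseteq> lie_map H h ` carrier (group_lie_ring G)"
  proof
    fix y assume y: "y \<in> carrier (group_lie_ring H)"
    \<comment> \<open>Preimages are chosen degree by degree; taking zero above a zero component
      keeps the chosen family finitely supported.\<close>
    have "\<exists>X \<in> carrier (gr G i). gr_map H h i X = y i \<and> (y i = \<one>\<^bsub>gr H i\<^esub> \<longrightarrow> X = \<one>\<^bsub>gr G i\<^esub>)"
      if "i \<ge> 1" for i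
    proof (cases "y i = \<one>\<^bsub>gr H i\<^esub>")
      case True
      interpret gr: group_hom "gr G i" "gr H i" "gr_map H h i" by (rule gr_map_group_hom)
      show ?thesis using True by (intro bexI[of _ "\<one>\<^bsub>gr G i\<^esub>"]) auto
    next
      case False
      obtain k where "k \<in> lower_central H i" "y i = gr_class H i k"
        using H.group_lie_ring_class[OF y \<open>i \<ge> 1\<close>] .
      moreover obtain g where "g \<in> lower_central G i" "k = h g"
        using calculation(1) lower_central_img[OF surj, of i] by blast
      ultimately show ?thesis
        using False by (intro bexI[of _ "gr_class G i g"]) (auto simp: gr_map_class G.gr_classI)
    qed
    then obtain X where X: "\<And>i. i \<ge> 1 \<Longrightarrow> X i \<in> carrier (gr G i)"
      "\<And>i. i \<ge> 1 \<Longrightarrow> gr_map H h i (X i) = y i"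
      "\<And>i. i \<ge> 1 \<Longrightarrow> y i = \<one>\<^bsub>gr H i\<^esub> \<Longrightarrow> X i = \<one>\<^bsub>gr G i\<^esub>"
      by metis
    let ?x = "restrict X {1..}"
    have "{i \<in> {1..}. ?x i \<noteq> \<one>\<^bsub>gr G i\<^esub>} \<subseteq> {i \<in> {1..}. y i \<noteq> \<one>\<^bsub>gr H i\<^esub>}"
      using X(3) by auto
    moreover have "finite {i \<in> {1..}. y i \<noteq> \<one>\<^bsub>gr H i\<^esub>}"
      using y by (simp add: H.carrier_group_lie_ring)
    ultimately have "finite {i \<in> {1..}. ?x i \<noteq> \<one>\<^bsub>gr G i\<^esub>}" by (rule finite_subset)
    then have x: "?x \<in> carrier (group_lie_ring G)"
      using X(1) unfolding G.carrier_group_lie_ring by auto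
    have "lie_map H h ?x = y"
      using lie_map_closed[OF x] y by (rule H.group_lie_ring_eqI) (simp add: lie_map_eq X(2))
    then show "y \<in> lie_map H h ` carrier (group_lie_ring G)" using x by blast
  qed
qed

text \<open>Every component has a representative, and its image class does not depend on the choice;
  hence vanishing can be stated for all representatives at once.\<close>

lemma lie_map_eq_one_iff:
  assumes x: "x \<in> carrier (group_lie_ring G)"
  shows "lie_map H h x = \<one>\<^bsub>group_lie_ring H\<^esub> \<longleftrightarrow>
    (\<forall>i \<ge> 1. \<forall>g \<in> lower_central G i. x i = gr_class G i g \<longrightarrow> h g \<in> lower_central H (Suc i))"
    (is "_ \<longleftrightarrow> ?R")
proof -
  interpret L: group_hom "group_lie_ring G" "group_lie_ring H" "lie_map H h"
    by (rule lie_map_group_hom)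
  have "lie_map H h x = \<one>\<^bsub>group_lie_ring H\<^esub> \<longleftrightarrow> (\<forall>i \<ge> 1. lie_map H h x i = \<one>\<^bsub>gr H i\<^esub>)"
  proof
    assume "lie_map H h x = \<one>\<^bsub>group_lie_ring H\<^esub>"
    then show "\<forall>i \<ge> 1. lie_map H h x i = \<one>\<^bsub>gr H i\<^esub>" by (simp add: one_group_lie_ring)
  next
    assume "\<forall>i \<ge> 1. lie_map H h x i = \<one>\<^bsub>gr H i\<^esub>"
    then show "lie_map H h x = \<one>\<^bsub>group_lie_ring H\<^esub>"
      using H.group_lie_ring_eqI[OF lie_map_closed[OF x] L.H.one_closed]
      by (simp add: one_group_lie_ring)
  qed
  also have "\<dots> \<longleftrightarrow> ?R"
  proof -
    have "lie_map H h x i = \<one>\<^bsub>gr H i\<^esub> \<longleftrightarrow> h g \<in> lower_central H (Suc i)"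
      if "i \<ge> 1" "g \<in> lower_central G i" "x i = gr_class G i g" for i g
      using that by (simp add: lie_map_eq gr_map_class H.gr_class_eq_one_iff G.lower_central_carrier)
    then show ?thesis using G.group_lie_ring_class[OF x] by metis
  qed
  finally show ?thesis .
qed

end


section \<open>The canonical projection\<close>

lemma UN2_constant:
  "\<lbrakk>a \<in> A; b \<in> B; \<And>x y. \<lbrakk>x \<in> A; y \<in> B\<rbrakk> \<Longrightarrow> F x y = C\<rbrakk> \<Longrightarrow> (\<Union>x \<in> A. \<Union>y \<in> B. F x y) = C"
  by blast

context group
begin

lemma center_quotient_hom:
  "group_hom G (G Mod group_center G) (\<lambda>g. group_center G #> g)"
  using normal.factorgroup_is_group[OF group_center_normal]
    normal.r_coset_hom_Mod[OF group_center_normal]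
  by (simp add: group_hom_def group_hom_axioms_def is_group)

text \<open>The quotient map is surjective, so term n of the quotient is the image of term n of G,
  and its preimage is the product of that term with the center.\<close>

lemma center_quotient_lower_central_iff:
  assumes g: "g \<in> carrier G"
  shows "group_center G #> g \<in> lower_central (G Mod group_center G) n \<longleftrightarrow>
    (\<exists>c \<in> lower_central G n. g \<otimes> inv c \<in> group_center G)"
proof -
  interpret f: group_hom G "G Mod group_center G" "\<lambda>g. group_center G #> g"
    by (rule center_quotient_hom)
  interpret Z: normal "group_center G" G by (rule group_center_normal)
  have "(\<lambda>g. group_center G #> g) ` lower_central G n = lower_central (G Mod group_center G) n"
    by (rule f.lower_central_img) (simp add: carrier_FactGroup)
  then have "group_center G #> g \<in> lower_central (G Mod group_center G) n \<longleftrightarrow>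
      (\<exists>c \<in> lower_central G n. group_center G #> g = group_center G #> c)"
    by blast
  moreover have "group_center G #> g = group_center G #> c \<longleftrightarrow> g \<otimes> inv c \<in> group_center G"
    if c: "c \<in> lower_central G n" for c
    using Z.rcos_module[OF is_group lower_central_carrier[OF c] g] rcos_self[OF g Z.subgroup_axioms]
      repr_independence[OF _ lower_central_carrier[OF c] Z.subgroup_axioms, of g]
    by metis
  ultimately show ?thesis by blast
qed

text \<open>Here g is a central element times some c in term i + 1, and each factor raises degrees
  by i + 1. This places the kernel of the induced map of Lie rings inside the Lie center.\<close>

lemma center_quotient_degree_raising:
  assumes "i \<ge> 1" and g: "g \<in> lower_central G i"
    and "group_center G #> g \<in> lower_central (G Mod group_center G) (Suc i)"
  shows "g \<in> degree_raising G (Suc i)"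
proof -
  interpret D: subgroup "degree_raising G (Suc i)" G by (rule degree_raising_subgroup)
  note gc = lower_central_carrier[OF g]
  obtain c where c: "c \<in> lower_central G (Suc i)" "g \<otimes> inv c \<in> group_center G"
    using assms(3) center_quotient_lower_central_iff[OF gc] by blast
  have "g \<otimes> inv c \<in> degree_raising G (Suc i)"
    using c(2) group_center_subset_degree_raising by blast
  moreover have "c \<in> degree_raising G (Suc i)"
    using c(1) lower_central_degree_raising[of "Suc i"] by auto
  ultimately have "g \<otimes> inv c \<otimes> c \<in> degree_raising G (Suc i)" by (rule D.m_closed)
  then show ?thesis using gc lower_central_carrier[OF c(1)] by (simp add: m_assoc)
qed

text \<open>The kernel of the induced surjection \<pi> lies in the Lie center, so sending
  \<open>?\<pi> x\<close> to the coset of x is well defined and always gives a surjective Lie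
  homomorphism. It is injective exactly when, conversely, \<pi> kills the Lie center.\<close>

lemma canonical_projection_lie_iso_iff_kernel:
  "canonical_projection G \<in> lie_iso (group_lie_ring (G Mod group_center G))
      (lie_quotient (group_lie_ring G) (lie_center (group_lie_ring G))) \<longleftrightarrow>
    (\<forall>x \<in> lie_center (group_lie_ring G).
       lie_map (G Mod group_center G) (\<lambda>g. group_center G #> g) x
         = \<one>\<^bsub>group_lie_ring (G Mod group_center G)\<^esub>)"
proof -
  let ?H = "G Mod group_center G" and ?f = "\<lambda>g. group_center G #> g"
  let ?L = "group_lie_ring G" and ?M = "group_lie_ring ?H"
  let ?I = "lie_center ?L" and ?\<pi> = "lie_map ?H ?f" and ?p = "canonical_projection G"
  let ?Q = "lie_quotient ?L ?I"
  interpret f: group_hom G ?H ?f by (rule center_quotient_hom)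
  interpret L: comm_group ?L by (rule comm_group_group_lie_ring)
  interpret I: normal ?I ?L by (rule L.subgroup_imp_normal[OF lie_center_subgroup])
  interpret \<pi>: group_hom ?L ?M ?\<pi> by (rule f.lie_map_group_hom)
  have surj: "?\<pi> ` carrier ?L = carrier ?M"
    by (rule f.lie_map_surj) (simp add: carrier_FactGroup)
  have lift: "\<exists>x \<in> carrier ?L. u = ?\<pi> x" if "u \<in> carrier ?M" for u
    using that unfolding surj[symmetric] by (rule imageE) blast
  have ker: "x \<in> ?I" if x: "x \<in> carrier ?L" and "?\<pi> x = \<one>\<^bsub>?M\<^esub>" for x
  proof -
    have "\<exists>g \<in> lower_central G i \<inter> degree_raising G (Suc i). x i = gr_class G i g"
      if i: "i \<ge> 1" for i
    proof -
      obtain g where g: "g \<in> lower_central G i" "x i = gr_class G i g"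
        using group_lie_ring_class[OF x i] .
      then have "?f g \<in> lower_central ?H (Suc i)"
        using f.lie_map_eq_one_iff[OF x] \<open>?\<pi> x = \<one>\<^bsub>?M\<^esub>\<close> i by blast
      then show ?thesis using center_quotient_degree_raising[OF i g(1)] g by blast
    qed
    then show ?thesis using x by (simp add: lie_center_class_iff)
  qed
  have coset_eq_iff: "?I #>\<^bsub>?L\<^esub> x = ?I #>\<^bsub>?L\<^esub> y \<longleftrightarrow> x \<otimes>\<^bsub>?L\<^esub> inv\<^bsub>?L\<^esub> y \<in> ?I"
    if "x \<in> carrier ?L" "y \<in> carrier ?L" for x y
    using that I.rcos_module[OF L.is_group that(2,1)] L.rcos_self[OF that(1) I.subgroup_axioms]
      L.repr_independence[OF _ that(2) I.subgroup_axioms, of x]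
    by metis
  have \<pi>_eq_iff: "?\<pi> x = ?\<pi> y \<longleftrightarrow> ?\<pi> (x \<otimes>\<^bsub>?L\<^esub> inv\<^bsub>?L\<^esub> y) = \<one>\<^bsub>?M\<^esub>"
    if "x \<in> carrier ?L" "y \<in> carrier ?L" for x y
    using that \<pi>.H.inv_solve_right'[of "\<one>\<^bsub>?M\<^esub>" "?\<pi> x" "?\<pi> y"] by auto
  \<comment> \<open>Uniqueness behind the \<open>THE\<close>: two preimages of one element differ by
    an element of the kernel, hence of the Lie center, and so have the same coset.\<close>
  have p: "?p (?\<pi> x) = ?I #>\<^bsub>?L\<^esub> x" if x: "x \<in> carrier ?L" for x
    unfolding canonical_projection_def
  proof (rule the_equality)
    fix Y assume "\<exists>x' \<in> carrier ?L. ?\<pi> x' = ?\<pi> x \<and> Y = ?I #>\<^bsub>?L\<^esub> x'"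
    then obtain x' where x': "x' \<in> carrier ?L" "?\<pi> x' = ?\<pi> x" "Y = ?I #>\<^bsub>?L\<^esub> x'" by blast
    have "x' \<otimes>\<^bsub>?L\<^esub> inv\<^bsub>?L\<^esub> x \<in> ?I"
      using \<pi>_eq_iff[OF x'(1) x] x' x by (intro ker L.m_closed L.inv_closed) simp_all
    then show "Y = ?I #>\<^bsub>?L\<^esub> x" using coset_eq_iff[OF x'(1) x] x'(3) by simp
  qed (use x in blast)
  have carrier_Q: "carrier ?Q = (\<lambda>x. ?I #>\<^bsub>?L\<^esub> x) ` carrier ?L"
    by (simp add: lie_quotient_def carrier_FactGroup)
  have mult_Q: "(?I #>\<^bsub>?L\<^esub> x) \<otimes>\<^bsub>?Q\<^esub> (?I #>\<^bsub>?L\<^esub> y) = ?I #>\<^bsub>?L\<^esub> (x \<otimes>\<^bsub>?L\<^esub> y)"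
    if "x \<in> carrier ?L" "y \<in> carrier ?L" for x y
    using I.rcos_sum[OF that] by (simp add: lie_quotient_def)
  have bracket_Q: "bracket ?Q (?I #>\<^bsub>?L\<^esub> x) (?I #>\<^bsub>?L\<^esub> y) = ?I #>\<^bsub>?L\<^esub> bracket ?L x y"
    if x: "x \<in> carrier ?L" and y: "y \<in> carrier ?L" for x y
  proof -
    have "?I #>\<^bsub>?L\<^esub> bracket ?L x' y' = ?I #>\<^bsub>?L\<^esub> bracket ?L x y"
      if x': "x' \<in> ?I #>\<^bsub>?L\<^esub> x" and y': "y' \<in> ?I #>\<^bsub>?L\<^esub> y" for x' y'
    proof -
      obtain z w where zw: "z \<in> ?I" "x' = z \<otimes>\<^bsub>?L\<^esub> x" "w \<in> ?I" "y' = w \<otimes>\<^bsub>?L\<^esub> y"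
        using x' y' unfolding r_coset_def by blast
      note c = I.mem_carrier[OF zw(1)] I.mem_carrier[OF zw(3)]
      \<comment> \<open>Expanding the bracket of z + x with w + y biadditively leaves only the
        bracket of x and y, as z and w are central.\<close>
      have "bracket ?L z v = \<one>\<^bsub>?L\<^esub>" if "v \<in> carrier ?L" for v
        using zw(1) that unfolding lie_center_def by blast
      moreover have "bracket ?L x w = \<one>\<^bsub>?L\<^esub>" by (rule lie_center_bracket_right[OF zw(3) x])
      ultimately show ?thesis
        using c x y unfolding zw(2,4)
        by (simp add: bracket_mult_left bracket_mult_right bracket_closed)
    qed
    moreover have "x \<in> ?I #>\<^bsub>?L\<^esub> x" "y \<in> ?I #>\<^bsub>?L\<^esub> y"
      using x y L.rcos_self I.subgroup_axioms by blast+
    ultimately have "(\<Union>x' \<in> ?I #>\<^bsub>?L\<^esub> x. \<Union>y' \<in> ?I #>\<^bsub>?L\<^esub> y. ?I #>\<^bsub>?L\<^esub> bracket ?L x' y')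
        = ?I #>\<^bsub>?L\<^esub> bracket ?L x y"
      by (intro UN2_constant)
    then show ?thesis by (simp add: lie_quotient_def)
  qed
  have "?p \<in> hom ?M ?Q"
  proof (rule homI)
    fix u assume "u \<in> carrier ?M"
    then show "?p u \<in> carrier ?Q" unfolding carrier_Q surj[symmetric] using p by auto
  next
    fix u v assume "u \<in> carrier ?M" "v \<in> carrier ?M"
    then obtain x y where xy: "x \<in> carrier ?L" "y \<in> carrier ?L" "u = ?\<pi> x" "v = ?\<pi> y"
      using lift[of u] lift[of v] by blast
    then have "?p (u \<otimes>\<^bsub>?M\<^esub> v) = ?p (?\<pi> (x \<otimes>\<^bsub>?L\<^esub> y))" by (simp only: \<pi>.hom_mult)
    then show "?p (u \<otimes>\<^bsub>?M\<^esub> v) = ?p u \<otimes>\<^bsub>?Q\<^esub> ?p v" using xy by (simp only: p mult_Q L.m_closed)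
  qed
  moreover have "?p (bracket ?M u v) = bracket ?Q (?p u) (?p v)"
    if uv: "u \<in> carrier ?M" "v \<in> carrier ?M" for u v
  proof -
    obtain x y where xy: "x \<in> carrier ?L" "y \<in> carrier ?L" "u = ?\<pi> x" "v = ?\<pi> y"
      using lift[OF uv(1)] lift[OF uv(2)] by blast
    then have "?p (bracket ?M u v) = ?p (?\<pi> (bracket ?L x y))" by (simp only: f.lie_map_bracket)
    then show ?thesis using xy by (simp only: p bracket_Q bracket_closed)
  qed
  moreover have "?p ` carrier ?M = carrier ?Q"
    unfolding carrier_Q surj[symmetric] image_image using p by auto
  ultimately have "?p \<in> lie_iso ?M ?Q \<longleftrightarrow> inj_on ?p (carrier ?M)"
    by (simp add: lie_iso_def iso_def bij_betw_def)
  also have "\<dots> \<longleftrightarrow> (\<forall>x \<in> ?I. ?\<pi> x = \<one>\<^bsub>?M\<^esub>)"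
  proof
    assume inj: "inj_on ?p (carrier ?M)"
    show "\<forall>x \<in> ?I. ?\<pi> x = \<one>\<^bsub>?M\<^esub>"
    proof
      fix x assume x: "x \<in> ?I"
      have "?I #>\<^bsub>?L\<^esub> x = ?I #>\<^bsub>?L\<^esub> \<one>\<^bsub>?L\<^esub>" using x by (subst coset_eq_iff) auto
      then have "?p (?\<pi> x) = ?p (?\<pi> \<one>\<^bsub>?L\<^esub>)" using x by (simp only: p I.mem_carrier L.one_closed)
      then have "?\<pi> x = ?\<pi> \<one>\<^bsub>?L\<^esub>" using x by (intro inj_onD[OF inj]) auto
      then show "?\<pi> x = \<one>\<^bsub>?M\<^esub>" by simp
    qed
  next
    assume triv: "\<forall>x \<in> ?I. ?\<pi> x = \<one>\<^bsub>?M\<^esub>"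
    show "inj_on ?p (carrier ?M)"
    proof (rule inj_onI)
      fix u v assume "u \<in> carrier ?M" "v \<in> carrier ?M" and eq: "?p u = ?p v"
      then obtain x y where xy: "x \<in> carrier ?L" "y \<in> carrier ?L" "u = ?\<pi> x" "v = ?\<pi> y"
        using lift[of u] lift[of v] by blast
      then have "x \<otimes>\<^bsub>?L\<^esub> inv\<^bsub>?L\<^esub> y \<in> ?I" using eq by (simp add: p coset_eq_iff)
      then show "u = v" using xy triv \<pi>_eq_iff by blast
    qed
  qed
  finally show ?thesis .
qed

lemma lie_class_lie_center:
  assumes "g \<in> lower_central G i \<inter> degree_raising G (Suc i)"
  shows "lie_class G i g \<in> lie_center (group_lie_ring G)"
proof -
  have "\<exists>g' \<in> lower_central G j \<inter> degree_raising G (Suc j). lie_class G i g j = gr_class G j g'"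
    if "j \<ge> 1" for j
  proof (cases "j = i")
    case True
    then show ?thesis using assms that by (intro bexI[of _ g]) (auto simp: lie_class_component)
  next
    case False
    then show ?thesis
      using that subgroup.one_closed[OF degree_raising_subgroup, of "Suc j"]
      by (intro bexI[of _ \<one>]) (auto simp: lie_class_component gr_class_one)
  qed
  then show ?thesis using assms by (simp add: lie_center_class_iff lie_class_closed)
qed

text \<open>The kernel criterion tested on homogeneous classes gives the condition for each g;
  conversely, a central element of the Lie ring is treated component by component.\<close>

lemma canonical_projection_lie_iso_iff_graded:
  "canonical_projection G \<in> lie_iso (group_lie_ring (G Mod group_center G))
      (lie_quotient (group_lie_ring G) (lie_center (group_lie_ring G))) \<longleftrightarrow>
    (\<forall>i \<ge> 1. \<forall>g \<in> lower_central G i \<inter> degree_raising G (Suc i).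
       \<exists>z \<in> group_center G \<inter> lower_central G i. g \<otimes> inv z \<in> lower_central G (Suc i))"
  (is "_ \<longleftrightarrow> ?R")
proof -
  let ?H = "G Mod group_center G" and ?f = "\<lambda>g. group_center G #> g"
  interpret f: group_hom G ?H ?f by (rule center_quotient_hom)
  \<comment> \<open>The central factor and the factor in term i + 1 exchange roles: z is
    \<open>g \<otimes> inv c\<close> in one direction, c is \<open>g \<otimes> inv z\<close> in the
    other. In the first, \<open>g \<otimes> inv z\<close> is the conjugate of c by g, and normality
    applies.\<close>
  have central: "?f g \<in> lower_central ?H (Suc i) \<longleftrightarrow>
      (\<exists>z \<in> group_center G \<inter> lower_central G i. g \<otimes> inv z \<in> lower_central G (Suc i))"
    if g: "g \<in> lower_central G i" for i g
  proof -
    note gc = lower_central_carrier[OF g]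
    have "?f g \<in> lower_central ?H (Suc i) \<longleftrightarrow>
        (\<exists>c \<in> lower_central G (Suc i). g \<otimes> inv c \<in> group_center G)"
      by (rule center_quotient_lower_central_iff[OF gc])
    also have "\<dots> \<longleftrightarrow>
        (\<exists>z \<in> group_center G \<inter> lower_central G i. g \<otimes> inv z \<in> lower_central G (Suc i))"
    proof
      assume "\<exists>c \<in> lower_central G (Suc i). g \<otimes> inv c \<in> group_center G"
      then obtain c where c: "c \<in> lower_central G (Suc i)" "g \<otimes> inv c \<in> group_center G" by blast
      have "c \<in> lower_central G i" using c(1) lower_central_Suc_subset by blast
      then have "g \<otimes> inv c \<in> lower_central G i"
        using g by (simp add: lower_central_mult lower_central_inv)
      moreover have "g \<otimes> inv (g \<otimes> inv c) = g \<otimes> c \<otimes> inv g"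
        using gc lower_central_carrier[OF c(1)] by (simp add: inv_mult_group m_assoc)
      then have "g \<otimes> inv (g \<otimes> inv c) \<in> lower_central G (Suc i)"
        using normal.inv_op_closed2[OF lower_central_normal gc c(1)] by (simp only:)
      ultimately show "\<exists>z \<in> group_center G \<inter> lower_central G i. g \<otimes> inv z \<in> lower_central G (Suc i)"
        using c(2) by blast
    next
      assume "\<exists>z \<in> group_center G \<inter> lower_central G i. g \<otimes> inv z \<in> lower_central G (Suc i)"
      then obtain z where z: "z \<in> group_center G" "g \<otimes> inv z \<in> lower_central G (Suc i)" by blast
      note zc = group_center_carrier[OF z(1)]
      have "g \<otimes> inv (g \<otimes> inv z) = z"
        using gc zc group_centerD[OF z(1), of "inv g"] by (simp add: inv_mult_group m_assoc)
      then show "\<exists>c \<in> lower_central G (Suc i). g \<otimes> inv c \<in> group_center G"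
        using z by (metis)
    qed
    finally show ?thesis .
  qed
  have "(\<forall>x \<in> lie_center (group_lie_ring G). lie_map ?H ?f x = \<one>\<^bsub>group_lie_ring ?H\<^esub>) \<longleftrightarrow>
    (\<forall>i \<ge> 1. \<forall>g \<in> lower_central G i \<inter> degree_raising G (Suc i). ?f g \<in> lower_central ?H (Suc i))"
    (is "?A \<longleftrightarrow> ?B")
  proof
    assume A: ?A
    show ?B
    proof (intro allI impI ballI)
      fix i g assume i: "i \<ge> (1::nat)" and g: "g \<in> lower_central G i \<inter> degree_raising G (Suc i)"
      note x = lie_class_lie_center[OF g]
      then have "lie_map ?H ?f (lie_class G i g) = \<one>\<^bsub>group_lie_ring ?H\<^esub>" using A by blast
      moreover have "lie_class G i g \<in> carrier (group_lie_ring G)" using g lie_class_closed by blast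
      moreover have "lie_class G i g i = gr_class G i g" using i by (simp add: lie_class_component)
      ultimately show "?f g \<in> lower_central ?H (Suc i)"
        using f.lie_map_eq_one_iff g i by blast
    qed
  next
    assume B: ?B
    show ?A
    proof
      fix x assume x: "x \<in> lie_center (group_lie_ring G)"
      note xc = x[unfolded lie_center_class_iff, THEN conjunct1]
      have "?f g \<in> lower_central ?H (Suc i)"
        if i: "i \<ge> 1" and g: "g \<in> lower_central G i" "x i = gr_class G i g" for i g
      proof -
        \<comment> \<open>The representative g is arbitrary, while g' is one known to raise degrees;
          their images have the same class, so the conclusion for g' carries over to g.\<close>
        obtain g' where g': "g' \<in> lower_central G i \<inter> degree_raising G (Suc i)"
            "x i = gr_class G i g'"
          using x i unfolding lie_center_class_iff by blast
        have "gr_class ?H i (?f g) = gr_class ?H i (?f g')"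
          using g g' by (metis IntE f.gr_map_class)
        moreover have "?f g \<in> carrier ?H" "?f g' \<in> carrier ?H"
          using g(1) g'(1) f.hom_closed lower_central_carrier by blast+
        moreover have "?f g' \<in> lower_central ?H (Suc i)" using B i g'(1) by blast
        ultimately show ?thesis using f.H.gr_class_eq_one_iff by metis
      qed
      then show "lie_map ?H ?f x = \<one>\<^bsub>group_lie_ring ?H\<^esub>"
        unfolding f.lie_map_eq_one_iff[OF xc] by blast
    qed
  qed
  also have "\<dots> \<longleftrightarrow> ?R" using central by (metis IntE)
  finally show ?thesis unfolding canonical_projection_lie_iso_iff_kernel .
qed

text \<open>The homogeneous central elements of degree i are the classes of the elements of term i
  that raise degrees by i + 1, and two such classes agree iff their representatives agree modulo
  term i + 1.\<close>

lemma homogeneous_central_iff_graded: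
  "(\<forall>i \<ge> 1. \<forall>x \<in> lie_center (group_lie_ring G). homogeneous G i x \<longrightarrow>
      (\<exists>z \<in> group_center G \<inter> lower_central G i. x = lie_class G i z)) \<longleftrightarrow>
    (\<forall>i \<ge> 1. \<forall>g \<in> lower_central G i \<inter> degree_raising G (Suc i).
       \<exists>z \<in> group_center G \<inter> lower_central G i. g \<otimes> inv z \<in> lower_central G (Suc i))"
  (is "?A \<longleftrightarrow> ?B")
proof -
  have eq: "lie_class G i g = lie_class G i z \<longleftrightarrow> g \<otimes> inv z \<in> lower_central G (Suc i)"
    if "i \<ge> 1" "g \<in> lower_central G i" "z \<in> lower_central G i" for i g z
  proof -
    have "lie_class G i g = lie_class G i z \<longleftrightarrow> gr_class G i g = gr_class G i z"
    proof
      assume "lie_class G i g = lie_class G i z"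
      then show "gr_class G i g = gr_class G i z"
        using lie_class_component[OF that(1), of i] by metis
    next
      assume "gr_class G i g = gr_class G i z"
      then show "lie_class G i g = lie_class G i z" unfolding lie_class_def gr_class_def by presburger
    qed
    then show ?thesis using that by (simp add: gr_class_eq_iff lower_central_carrier)
  qed
  show ?thesis
  proof
    assume A: ?A
    show ?B
    proof (intro allI impI ballI)
      fix i g assume i: "i \<ge> (1::nat)" and g: "g \<in> lower_central G i \<inter> degree_raising G (Suc i)"
      have "homogeneous G i (lie_class G i g)"
        using g by (auto simp: homogeneous_def lie_class_closed lie_class_component)
      then obtain z where "z \<in> group_center G \<inter> lower_central G i" "lie_class G i g = lie_class G i z"
        using A i lie_class_lie_center[OF g] by blast
      then show "\<exists>z \<in> group_center G \<inter> lower_central G i. g \<otimes> inv z \<in> lower_central G (Suc i)"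
        using eq[OF i] g by blast
    qed
  next
    assume B: ?B
    show ?A
    proof (intro allI impI ballI)
      fix i x assume i: "i \<ge> (1::nat)" and x: "x \<in> lie_center (group_lie_ring G)"
        and hom: "homogeneous G i x"
      obtain g where g: "g \<in> lower_central G i \<inter> degree_raising G (Suc i)" "x i = gr_class G i g"
        using x i unfolding lie_center_class_iff by blast
      have "x = lie_class G i g"
      proof (rule group_lie_ring_eqI)
        show "x j = lie_class G i g j" if "j \<ge> 1" for j
          using that hom g(2) by (simp add: homogeneous_def lie_class_component)
      qed (use g hom in \<open>auto simp: homogeneous_def lie_class_closed\<close>)
      then show "\<exists>z \<in> group_center G \<inter> lower_central G i. x = lie_class G i z"
        using B i g eq[OF i] by blast
    qed
  qed
qed

end

theorem corollary2p2:
  fixes G :: "('a, 'm) monoid_scheme"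
  assumes "group G"
  shows "(andreadakis_equality G (Inn G)
            \<longleftrightarrow> (\<forall>i \<ge> 1. \<forall>x \<in> lie_center (group_lie_ring G). homogeneous G i x \<longrightarrow>
                   (\<exists>z \<in> group_center G \<inter> lower_central G i. x = lie_class G i z)))
       \<and> (andreadakis_equality G (Inn G)
            \<longleftrightarrow> canonical_projection G \<in>
                  lie_iso (group_lie_ring (G Mod group_center G))
                          (lie_quotient (group_lie_ring G) (lie_center (group_lie_ring G))))"
proof -
  interpret group G by fact
  show ?thesis
    using andreadakis_equality_Inn_graded_iff homogeneous_central_iff_graded
      canonical_projection_lie_iso_iff_graded
    by simp
qed

end
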